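(* Let $c\in\mathbb{R}$ with $c\geq 1$ and let $k\in\mathbb{N}=\{0,1,2,\dots\}$. Let $G$ be a graph that is $c$-quasi-isometric to a graph $H$ of treewidth at most $k$. Then $G$ admits a proper partition $\mathcal{P}$ such that the quotient $G/\mathcal{P}$ has treewidth at most $k$ and every part of $\mathcal{P}$ has weak diameter in $G$ at most $4(k+1)c^2+c$.
   Context: For $c\geq 1$, a map $\phi:V(G)\to V(H)$ is a $c$-quasi-isometry from $G$ to $H$ if (1) for all distinct $u,v\in V(G)$, $\operatorname{dist}_G(u,v)\leq c\,\operatorname{dist}_H(\phi(u),\phi(v))+c$ and $\operatorname{dist}_H(\phi(u),\phi(v))\leq c\,\operatorname{dist}_G(u,v)+c$; and (2) for each $h\in V(H)$ there is $v\in V(G)$ with $\operatorname{dist}_H(h,\phi(v))\leq c$. $G$ is $c$-quasi-isometric to $H$ if such a map exists. A partition $\mathcal{P}$ of $G$ is a collection of pairwise disjoint subsets (parts) of $V(G)$ whose union is $V(G)$; it is proper if every part is nonempty. The quotient $G/\mathcal{P}$ is the simple graph with vertex set $\mathcal{P}$ in which distinct parts $P_1,P_2$ are adjacent iff there is an edge $uv\in E(G)$ with $u\in P_1$, $v\in P_2$. The weak diameter in $G$ of a set $S\subseteq V(G)$ is the maximum of $\operatorname{dist}_G(u,v)$ over $u,v\in S$ (distances measured in $G$, not in $G[S]$). Parts need not induce connected subgraphs. *)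

theory Defs
  imports "HOL-Library.Extended_Real" "HOL-Library.Disjoint_Sets" "HOL-Library.FuncSet"
begin

text \<open>Graphs are simple and undirected; the vertex set may be infinite or empty, and the graph
  may be disconnected.\<close>

record 'a graph =
  verts :: "'a set"
  edges :: "'a set set"

definition simple_graph :: "'a graph \<Rightarrow> bool" where
  "simple_graph G \<longleftrightarrow>
     (\<forall>e\<in>edges G. \<exists>u\<in>verts G. \<exists>v\<in>verts G. u \<noteq> v \<and> e = {u, v})"

definition walk :: "'a graph \<Rightarrow> 'a list \<Rightarrow> bool" where
  "walk G p \<longleftrightarrow>
     p \<noteq> [] \<and> set p \<subseteq> verts G \<and> successively (\<lambda>u v. {u, v} \<in> edges G) p"

text \<open>The infimum of the empty set is \<open>\<infinity>\<close>, so this is the distance of vertices in different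
  components.\<close>

definition gdist :: "'a graph \<Rightarrow> 'a \<Rightarrow> 'a \<Rightarrow> enat" where
  "gdist G u v = (INF p \<in> {p. walk G p \<and> hd p = u \<and> last p = v}. enat (length p - 1))"

definition quasi_isometry :: "real \<Rightarrow> 'a graph \<Rightarrow> 'b graph \<Rightarrow> ('a \<Rightarrow> 'b) \<Rightarrow> bool" where
  "quasi_isometry c G H \<phi> \<longleftrightarrow>
     \<phi> \<in> verts G \<rightarrow> verts H \<and>
     (\<forall>u\<in>verts G. \<forall>v\<in>verts G. u \<noteq> v \<longrightarrow>
        ereal_of_enat (gdist G u v) \<le> ereal c * ereal_of_enat (gdist H (\<phi> u) (\<phi> v)) + ereal c \<and>
        ereal_of_enat (gdist H (\<phi> u) (\<phi> v)) \<le> ereal c * ereal_of_enat (gdist G u v) + ereal c) \<and>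
     (\<forall>h\<in>verts H. \<exists>v\<in>verts G. ereal_of_enat (gdist H h (\<phi> v)) \<le> ereal c)"

definition quasi_isometric :: "real \<Rightarrow> 'a graph \<Rightarrow> 'b graph \<Rightarrow> bool" where
  "quasi_isometric c G H \<longleftrightarrow> (\<exists>\<phi>. quasi_isometry c G H \<phi>)"

definition weak_diameter :: "'a graph \<Rightarrow> 'a set \<Rightarrow> enat" where
  "weak_diameter G S = (SUP u\<in>S. SUP v\<in>S. gdist G u v)"

definition quotient_graph :: "'a graph \<Rightarrow> 'a set set \<Rightarrow> 'a set graph" where
  "quotient_graph G P =
     \<lparr>verts = P,
      edges = {{A, B} | A B. A \<in> P \<and> B \<in> P \<and> A \<noteq> B \<and> (\<exists>u\<in>A. \<exists>v\<in>B. {u, v} \<in> edges G)}\<rparr>"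

definition connected_graph :: "'a graph \<Rightarrow> bool" where
  "connected_graph G \<longleftrightarrow>
     verts G \<noteq> {} \<and> (\<forall>u\<in>verts G. \<forall>v\<in>verts G. \<exists>p. walk G p \<and> hd p = u \<and> last p = v)"

definition cycle :: "'a graph \<Rightarrow> 'a list \<Rightarrow> bool" where
  "cycle G p \<longleftrightarrow> walk G p \<and> distinct p \<and> 3 \<le> length p \<and> {last p, hd p} \<in> edges G"

definition tree :: "'a graph \<Rightarrow> bool" where
  "tree T \<longleftrightarrow> simple_graph T \<and> connected_graph T \<and> (\<nexists>p. cycle T p)"

definition induced_subgraph :: "'a graph \<Rightarrow> 'a set \<Rightarrow> 'a graph" where
  "induced_subgraph G S = \<lparr>verts = verts G \<inter> S, edges = {e \<in> edges G. e \<subseteq> S}\<rparr>"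

definition tree_decomposition :: "'a graph \<Rightarrow> 't graph \<Rightarrow> ('t \<Rightarrow> 'a set) \<Rightarrow> bool" where
  "tree_decomposition G T B \<longleftrightarrow>
     tree T \<and>
     (\<forall>x\<in>verts T. B x \<subseteq> verts G) \<and>
     (\<forall>e\<in>edges G. \<exists>x\<in>verts T. e \<subseteq> B x) \<and>
     (\<forall>v\<in>verts G. connected_graph (induced_subgraph T {x. v \<in> B x}))"

definition width_at_most :: "'t graph \<Rightarrow> ('t \<Rightarrow> 'a set) \<Rightarrow> nat \<Rightarrow> bool" where
  "width_at_most T B k \<longleftrightarrow> (\<forall>x\<in>verts T. finite (B x) \<and> card (B x) \<le> k + 1)"

text \<open>HOL cannot quantify over the type of the nodes of the decomposition tree, so nodes are
  taken from \<open>'a + nat\<close>. This is no restriction: by \<open>treewidth_leI\<close> below, a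
  decomposition over any node type gives one of at most the same width over \<open>'a + nat\<close>.
  The treewidth is \<open>\<infinity>\<close> if there is no decomposition of finite width.\<close>

definition treewidth :: "'a graph \<Rightarrow> enat" where
  "treewidth G =
     Inf {enat k | k. \<exists>(T :: ('a + nat) graph) B. tree_decomposition G T B \<and> width_at_most T B k}"


lemma walk_append_iff:
  "p \<noteq> [] \<Longrightarrow> q \<noteq> [] \<Longrightarrow>
     walk G (p @ q) \<longleftrightarrow> walk G p \<and> walk G q \<and> {last p, hd q} \<in> edges G"
  by (auto simp: walk_def successively_append_iff)

lemma walk_rev: "walk G (rev p) \<longleftrightarrow> walk G p"
  by (auto simp: walk_def insert_commute)

lemma walk_singleton [simp]: "walk G [u] \<longleftrightarrow> u \<in> verts G"
  by (auto simp: walk_def)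

lemma walk_join:
  assumes "walk G p" "walk G q" "last p = hd q"
  shows "\<exists>r. walk G r \<and> hd r = hd p \<and> last r = last q \<and> set r \<subseteq> set p \<union> set q"
proof (cases "tl q = []")
  case True
  with assms have "last q = hd q" by (cases q) (auto simp: walk_def)
  with assms show ?thesis by (intro exI[of _ p]) auto
next
  case False
  obtain a q' where q: "q = a # q'" using assms(2) by (cases q) (auto simp: walk_def)
  with False have "q' \<noteq> []" by simp
  with assms q have "walk G (p @ q')"
    by (subst walk_append_iff) (auto simp: walk_def successively_Cons)
  with \<open>q' \<noteq> []\<close> q assms show ?thesis
    by (intro exI[of _ "p @ q'"]) (auto simp: walk_def)
qed

lemma walk_distinct:
  "walk G p \<Longrightarrow>
     \<exists>q. walk G q \<and> distinct q \<and> hd q = hd p \<and> last q = last p \<and> set q \<subseteq> set p"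
proof (induction p rule: length_induct)
  case (1 p)
  show ?case
  proof (cases "distinct p")
    case False
    then obtain xs ys zs a where p: "p = xs @ [a] @ ys @ [a] @ zs"
      using not_distinct_decomp by metis
    define p' where "p' = xs @ [a] @ zs"
    have "walk G p'" "hd p' = hd p" "last p' = last p" "set p' \<subseteq> set p"
      using 1(2) unfolding p p'_def
      by (auto simp: walk_def successively_append_iff successively_Cons hd_append)
    moreover have "length p' < length p" by (simp add: p p'_def)
    ultimately show ?thesis using 1(1) by (metis subset_trans)
  qed (use 1 in blast)
qed

lemma walk_induced_subgraph:
  "walk (induced_subgraph G S) p \<longleftrightarrow> walk G p \<and> set p \<subseteq> S"
proof -
  have "successively (\<lambda>u v. {u, v} \<in> edges (induced_subgraph G S)) p \<longleftrightarrow>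
        successively (\<lambda>u v. {u, v} \<in> edges G) p" if "set p \<subseteq> S"
    using that by (induction p rule: induct_list012) (auto simp: induced_subgraph_def)
  then show ?thesis by (auto simp: walk_def) (auto simp: induced_subgraph_def)
qed

lemma tree_induced_subgraph:
  assumes "tree T" "connected_graph (induced_subgraph T S)"
  shows "tree (induced_subgraph T S)"
proof -
  have "simple_graph (induced_subgraph T S)"
    using assms(1) unfolding tree_def simple_graph_def induced_subgraph_def by fastforce
  moreover have "cycle T p" if "cycle (induced_subgraph T S) p" for p
    using that by (auto simp: cycle_def walk_induced_subgraph) (auto simp: induced_subgraph_def)
  ultimately show ?thesis using assms by (auto simp: tree_def)
qed

lemma tree_convex:
  assumes T: "tree T" and S: "connected_graph (induced_subgraph T S)"
    and p: "walk T p" "distinct p" "hd p \<in> S" "last p \<in> S"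
  shows "set p \<subseteq> S"
proof (rule ccontr)
  assume "\<not> set p \<subseteq> S"
  then have "\<exists>x\<in>set p. x \<notin> S" by auto
  then obtain p1 x p2 where d: "p = p1 @ x # p2" "x \<notin> S" "\<forall>y\<in>set p1. \<not> y \<notin> S"
    by (rule split_list_first_propE)
  then have "p1 \<noteq> []" "p2 \<noteq> []" using p by auto
  obtain q1 a where p1: "p1 = q1 @ [a]" using \<open>p1 \<noteq> []\<close> by (metis rev_exhaust)
  have "last p2 \<in> S" using d p \<open>p2 \<noteq> []\<close> by simp
  with \<open>p2 \<noteq> []\<close> have "\<exists>y\<in>set p2. y \<in> S" using last_in_set by blast
  then obtain m b q2 where p2: "p2 = m @ b # q2" "b \<in> S" "\<forall>y\<in>set m. y \<notin> S"
    by (rule split_list_first_propE)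
  define ms where "ms = x # m"
  have pp: "p = q1 @ [a] @ ms @ [b] @ q2" by (simp add: d p1 p2 ms_def)
  have a: "a \<in> S" using d p1 by simp
  have ms: "set ms \<inter> S = {}" "ms \<noteq> []" using d p2 by (auto simp: ms_def)
  have w: "walk T ms" "{a, hd ms} \<in> edges T" "{last ms, b} \<in> edges T" "a \<noteq> b" "distinct ms"
    "a \<in> verts T" "b \<in> verts T"
    using p ms(2) unfolding pp
    by (auto simp: walk_def successively_append_iff successively_Cons hd_append)
  then obtain q where "walk (induced_subgraph T S) q" "hd q = b" "last q = a"
    using S a p2(2) unfolding connected_graph_def
    by (metis (no_types, lifting) IntI graph.select_convs(1) induced_subgraph_def)
  then obtain q where q: "walk (induced_subgraph T S) q" "distinct q" "hd q = b" "last q = a"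
    using walk_distinct by metis
  then have qT: "walk T q" "set q \<subseteq> S" by (simp_all add: walk_induced_subgraph)
  then have "q \<noteq> []" by (simp add: walk_def)
  have "length q \<ge> 2"
    using q \<open>a \<noteq> b\<close> \<open>q \<noteq> []\<close> by (cases q; cases "tl q") auto
  moreover have "length ms \<ge> 1" using ms(2) by (cases ms) auto
  ultimately have "cycle T (q @ ms)"
    using q qT \<open>q \<noteq> []\<close> w ms by (auto simp: cycle_def walk_append_iff)
  then show False using T by (auto simp: tree_def)
qed

lemma tree_induced_subgraph_Int:
  assumes T: "tree T" and S: "connected_graph (induced_subgraph T S)"
    and R: "connected_graph (induced_subgraph T R)" and ne: "verts T \<inter> S \<inter> R \<noteq> {}"
  shows "connected_graph (induced_subgraph (induced_subgraph T S) R)"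
  unfolding connected_graph_def
proof (intro conjI ballI)
  show "verts (induced_subgraph (induced_subgraph T S) R) \<noteq> {}"
    using ne by (simp add: induced_subgraph_def)
next
  fix u v
  assume "u \<in> verts (induced_subgraph (induced_subgraph T S) R)"
    and "v \<in> verts (induced_subgraph (induced_subgraph T S) R)"
  then have uv: "u \<in> verts T" "u \<in> S" "u \<in> R" "v \<in> verts T" "v \<in> S" "v \<in> R"
    by (auto simp: induced_subgraph_def)
  then obtain p where "walk (induced_subgraph T R) p" "hd p = u" "last p = v"
    using R by (auto simp: connected_graph_def induced_subgraph_def)
  then obtain p where p: "walk (induced_subgraph T R) p" "distinct p" "hd p = u" "last p = v"
    using walk_distinct by metis
  then have "walk T p" "set p \<subseteq> R" by (auto simp: walk_induced_subgraph)
  moreover have "set p \<subseteq> S"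
    using tree_convex[OF T S \<open>walk T p\<close> p(2)] p uv by simp
  ultimately show "\<exists>p. walk (induced_subgraph (induced_subgraph T S) R) p \<and> hd p = u \<and> last p = v"
    using p by (intro exI[of _ p]) (auto simp: walk_induced_subgraph)
qed

lemma tree_decomposition_induced_subgraph:
  assumes td: "tree_decomposition G T B" and S: "connected_graph (induced_subgraph T S)"
    and V: "\<And>v. v \<in> verts G \<Longrightarrow> \<exists>x\<in>verts T \<inter> S. v \<in> B x"
    and E: "\<And>e. e \<in> edges G \<Longrightarrow> \<exists>x\<in>verts T \<inter> S. e \<subseteq> B x"
  shows "tree_decomposition G (induced_subgraph T S) B"
proof -
  have T: "tree T" using td by (simp add: tree_decomposition_def)
  have "connected_graph (induced_subgraph (induced_subgraph T S) {x. v \<in> B x})"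
    if v: "v \<in> verts G" for v
  proof (rule tree_induced_subgraph_Int[OF T S])
    show "connected_graph (induced_subgraph T {x. v \<in> B x})"
      using td v by (simp add: tree_decomposition_def)
    show "verts T \<inter> S \<inter> {x. v \<in> B x} \<noteq> {}" using V[OF v] by blast
  qed
  then show ?thesis
    using td tree_induced_subgraph[OF T S] E
    by (auto simp: tree_decomposition_def) (auto simp: induced_subgraph_def)
qed

definition map_graph :: "('a \<Rightarrow> 'b) \<Rightarrow> 'a graph \<Rightarrow> 'b graph" where
  "map_graph f G = \<lparr>verts = f ` verts G, edges = (`) f ` edges G\<rparr>"

lemma edges_map_graph:
  assumes "simple_graph G" "inj_on f (verts G)" "u \<in> verts G" "v \<in> verts G"
  shows "{f u, f v} \<in> edges (map_graph f G) \<longleftrightarrow> {u, v} \<in> edges G"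
proof
  assume "{f u, f v} \<in> edges (map_graph f G)"
  then obtain e where e: "e \<in> edges G" "f ` {u, v} = f ` e" by (auto simp: map_graph_def)
  then have "e \<subseteq> verts G" using assms(1) by (auto simp: simple_graph_def)
  with e have "{u, v} = e"
    using inj_on_image_eq_iff[OF assms(2), of "{u, v}" e] assms(3,4) by simp
  with e show "{u, v} \<in> edges G" by simp
next
  assume "{u, v} \<in> edges G"
  then have "f ` {u, v} \<in> edges (map_graph f G)" unfolding map_graph_def by (auto intro: imageI simp del: image_insert)
  then show "{f u, f v} \<in> edges (map_graph f G)" by simp
qed

lemma walk_map_graph:
  assumes "simple_graph G" "inj_on f (verts G)" "set p \<subseteq> verts G"
  shows "walk (map_graph f G) (map f p) \<longleftrightarrow> walk G p"
proof -
  have "successively (\<lambda>u v. {f u, f v} \<in> edges (map_graph f G)) p \<longleftrightarrow>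
        successively (\<lambda>u v. {u, v} \<in> edges G) p"
    using assms(3)
    by (induction p rule: induct_list012) (auto simp: edges_map_graph[OF assms(1,2)])
  then show ?thesis
    using assms(3) by (auto simp: walk_def successively_map) (auto simp: map_graph_def)
qed

lemma walk_map_graphE:
  assumes "simple_graph G" "inj_on f (verts G)" "walk (map_graph f G) q"
  obtains p where "q = map f p" "walk G p" "set p \<subseteq> verts G"
proof -
  have "set q \<subseteq> f ` verts G" using assms(3) by (auto simp: walk_def map_graph_def)
  then have "q \<in> lists (f ` verts G)" by auto
  then obtain p where "p \<in> lists (verts G)" "q = map f p" unfolding lists_image by blast
  then have "set p \<subseteq> verts G" "q = map f p" by auto
  with that show thesis using walk_map_graph[OF assms(1,2)] assms(3) by blast
qed

lemma connected_map_graph: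
  assumes "simple_graph G" "inj_on f (verts G)" "connected_graph G"
  shows "connected_graph (map_graph f G)"
  unfolding connected_graph_def
proof (intro conjI ballI)
  show "verts (map_graph f G) \<noteq> {}"
    using assms(3) by (simp add: map_graph_def connected_graph_def)
next
  fix u v assume "u \<in> verts (map_graph f G)" "v \<in> verts (map_graph f G)"
  then obtain a b where ab: "a \<in> verts G" "b \<in> verts G" "u = f a" "v = f b"
    by (auto simp: map_graph_def)
  then obtain p where p: "walk G p" "hd p = a" "last p = b"
    using assms(3) by (auto simp: connected_graph_def)
  then have "p \<noteq> []" "set p \<subseteq> verts G" by (auto simp: walk_def)
  then show "\<exists>q. walk (map_graph f G) q \<and> hd q = u \<and> last q = v"
    using p ab walk_map_graph[OF assms(1,2)]
    by (intro exI[of _ "map f p"]) (auto simp: hd_map last_map)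
qed

lemma simple_map_graph:
  assumes "simple_graph G" "inj_on f (verts G)"
  shows "simple_graph (map_graph f G)"
  unfolding simple_graph_def
proof
  fix e assume "e \<in> edges (map_graph f G)"
  then obtain u v where "u \<in> verts G" "v \<in> verts G" "u \<noteq> v" "e = f ` {u, v}"
    using assms(1) by (force simp: map_graph_def simple_graph_def)
  then show "\<exists>u\<in>verts (map_graph f G). \<exists>v\<in>verts (map_graph f G). u \<noteq> v \<and> e = {u, v}"
    using assms(2)
    by (intro bexI[of _ "f u"] bexI[of _ "f v"]) (auto simp: map_graph_def inj_on_def)
qed

lemma tree_map_graph:
  assumes T: "tree T" and f: "inj_on f (verts T)"
  shows "tree (map_graph f T)"
proof -
  have s: "simple_graph T" using T by (simp add: tree_def)
  have False if c: "cycle (map_graph f T) q" for q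
  proof -
    obtain p where p: "q = map f p" "walk T p" "set p \<subseteq> verts T"
      using walk_map_graphE[OF s f] c by (auto simp: cycle_def)
    then have "p \<noteq> []" by (auto simp: walk_def)
    then have "hd p \<in> verts T" "last p \<in> verts T" using p(3) by auto
    then have "cycle T p"
      using c p \<open>p \<noteq> []\<close> edges_map_graph[OF s f]
      by (auto simp: cycle_def distinct_map hd_map last_map)
    then show False using T by (auto simp: tree_def)
  qed
  then show ?thesis
    using T simple_map_graph[OF s f] connected_map_graph[OF s f] by (auto simp: tree_def)
qed

lemma tree_decomposition_map_graph:
  assumes td: "tree_decomposition G T B" and f: "inj_on f (verts T)"
  shows "tree_decomposition G (map_graph f T) (\<lambda>y. B (inv_into (verts T) f y))"
proof -
  let ?B = "\<lambda>y. B (inv_into (verts T) f y)"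
  have T: "tree T" and s: "simple_graph T"
    using td by (auto simp: tree_decomposition_def tree_def)
  have B: "?B (f x) = B x" if "x \<in> verts T" for x using f that by simp
  have "connected_graph (induced_subgraph (map_graph f T) {y. v \<in> ?B y})" if "v \<in> verts G" for v
  proof -
    let ?I = "induced_subgraph T {x. v \<in> B x}"
    have sub: "e \<subseteq> verts T" if "e \<in> edges T" for e using s that by (auto simp: simple_graph_def)
    have "f ` (verts T \<inter> {x. v \<in> B x}) = f ` verts T \<inter> {y. v \<in> ?B y}"
      using B by auto
    moreover have "(`) f ` {e \<in> edges T. e \<subseteq> {x. v \<in> B x}} =
        {e \<in> (`) f ` edges T. e \<subseteq> {y. v \<in> ?B y}}"
    proof -
      have "e \<subseteq> {x. v \<in> B x} \<longleftrightarrow> f ` e \<subseteq> {y. v \<in> ?B y}" if "e \<in> edges T" for e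
        using B sub[OF that] by (simp add: image_subset_iff) blast
      then show ?thesis by blast
    qed
    ultimately have "map_graph f ?I = induced_subgraph (map_graph f T) {y. v \<in> ?B y}"
      by (simp add: map_graph_def induced_subgraph_def)
    moreover have "connected_graph ?I" using td that by (auto simp: tree_decomposition_def)
    moreover have "simple_graph ?I"
      using tree_induced_subgraph[OF T \<open>connected_graph ?I\<close>] by (simp add: tree_def)
    moreover have "inj_on f (verts ?I)"
      using f by (auto simp: induced_subgraph_def inj_on_def)
    ultimately show ?thesis using connected_map_graph by metis
  qed
  moreover have "verts (map_graph f T) = f ` verts T" by (simp add: map_graph_def)
  ultimately show ?thesis
    using td tree_map_graph[OF T f] B by (simp add: tree_decomposition_def)
qed

context
  includes cardinal_syntax
begin

lemma tree_decomposition_small: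
  fixes G :: "'a graph" and T :: "'t graph"
  assumes G: "simple_graph G" and td: "tree_decomposition G T B"
  shows "\<exists>S f. connected_graph (induced_subgraph T S) \<and> S \<subseteq> verts T \<and>
      tree_decomposition G (induced_subgraph T S) B \<and> inj_on (f :: _ \<Rightarrow> 'a + nat) S"
proof -
  have conT: "connected_graph T" using td by (auto simp: tree_decomposition_def tree_def)
  then obtain r where r: "r \<in> verts T" by (auto simp: connected_graph_def)
  have "\<exists>x\<in>verts T. v \<in> B x" if "v \<in> verts G" for v
    using td that by (force simp: tree_decomposition_def connected_graph_def induced_subgraph_def)
  then obtain x where x: "\<And>v. v \<in> verts G \<Longrightarrow> x v \<in> verts T \<and> v \<in> B (x v)" by metis
  have "\<exists>x\<in>verts T. e \<subseteq> B x" if "e \<in> edges G" for e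
    using td that by (auto simp: tree_decomposition_def)
  then obtain y where y: "\<And>e. e \<in> edges G \<Longrightarrow> y e \<in> verts T \<and> e \<subseteq> B (y e)" by metis
  define N where "N = insert r (x ` verts G \<union> y ` edges G)"
  have NT: "N \<subseteq> verts T" using r x y by (auto simp: N_def)
  then have "\<exists>p. walk T p \<and> hd p = r \<and> last p = n" if "n \<in> N" for n
    using conT r that by (auto simp: connected_graph_def)
  then obtain W where W: "\<And>n. n \<in> N \<Longrightarrow> walk T (W n) \<and> hd (W n) = r \<and> last (W n) = n"
    by metis
  define S where "S = (\<Union>n\<in>N. set (W n))"
  have ST: "S \<subseteq> verts T" using W by (auto simp: S_def walk_def)
  have NS: "N \<subseteq> S"
  proof
    fix n assume "n \<in> N"
    then show "n \<in> S" using W[of n] last_in_set[of "W n"] by (auto simp: S_def walk_def)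
  qed
  have from_r: "\<exists>p. walk T p \<and> hd p = r \<and> last p = s \<and> set p \<subseteq> S" if s: "s \<in> S" for s
  proof -
    obtain n where n: "n \<in> N" "s \<in> set (W n)" using s unfolding S_def by blast
    then obtain p q where pq: "W n = p @ s # q" by (meson split_list)
    have "walk T (p @ [s])" "hd (p @ [s]) = r"
      using W[OF n(1)] unfolding pq
      by (auto simp: walk_def successively_append_iff hd_append)
    moreover have "set (p @ [s]) \<subseteq> S" using n(1) pq by (force simp: S_def)
    ultimately show ?thesis by (metis last_snoc)
  qed
  have conS: "connected_graph (induced_subgraph T S)"
    unfolding connected_graph_def
  proof (intro conjI ballI)
    show "verts (induced_subgraph T S) \<noteq> {}"
      using r NS by (auto simp: induced_subgraph_def N_def)
  next
    fix u v assume "u \<in> verts (induced_subgraph T S)" "v \<in> verts (induced_subgraph T S)"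
    then have "u \<in> S" "v \<in> S" by (auto simp: induced_subgraph_def)
    then obtain p q where p: "walk T p" "hd p = r" "last p = u" "set p \<subseteq> S"
      and q: "walk T q" "hd q = r" "last q = v" "set q \<subseteq> S"
      using from_r by meson
    have "p \<noteq> []" using p by (auto simp: walk_def)
    with p q show "\<exists>p. walk (induced_subgraph T S) p \<and> hd p = u \<and> last p = v"
      using walk_join[of T "rev p" q]
      by (auto simp: walk_rev last_rev hd_rev walk_induced_subgraph)
  qed
  have tdS: "tree_decomposition G (induced_subgraph T S) B"
  proof (rule tree_decomposition_induced_subgraph[OF td conS])
    show "\<exists>z\<in>verts T \<inter> S. v \<in> B z" if "v \<in> verts G" for v
      using x[OF that] NS that by (intro bexI[of _ "x v"]) (auto simp: N_def)
    show "\<exists>z\<in>verts T \<inter> S. e \<subseteq> B z" if "e \<in> edges G" for e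
      using y[OF that] NS that by (intro bexI[of _ "y e"]) (auto simp: N_def)
  qed
  let ?U = "UNIV :: ('a + nat) set"
  have inf: "infinite ?U" by simp
  have "|UNIV :: 'a set| \<le>o |?U|"
    by (rule card_of_ordLeq[THEN iffD1], rule exI[of _ Inl]) auto
  then have v: "|A| \<le>o |?U|" for A :: "'a set"
    using card_of_mono1[of A UNIV] ordLeq_transitive by blast
  have "edges G \<subseteq> (\<lambda>(a, b). {a, b}) ` (UNIV :: ('a \<times> 'a) set)"
    using G by (force simp: simple_graph_def)
  then have "|edges G| \<le>o |(UNIV :: ('a \<times> 'a) set)|"
    by (meson card_of_image card_of_mono1 ordLeq_transitive)
  also have "|(UNIV :: ('a \<times> 'a) set)| \<le>o |?U \<times> ?U|"
    using card_of_ordLeq[of "UNIV :: ('a \<times> 'a) set" "?U \<times> ?U"]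
    by (auto intro!: exI[of _ "map_prod Inl Inl"] simp: inj_on_def)
  also have "|?U \<times> ?U| =o |?U|" using card_of_Times_same_infinite[OF inf] .
  finally have e: "|edges G| \<le>o |?U|" .
  have fin: "|C| \<le>o |?U|" if "finite C" for C :: "'t set"
    using that inf
    by (intro ordLess_imp_ordLeq finite_ordLess_infinite)
      (auto simp: card_of_well_order_on Field_card_of)
  have Un: "|C \<union> D| \<le>o |?U|" if "|C| \<le>o |?U|" "|D| \<le>o |?U|" for C D :: "'t set"
    using card_of_Un_ordLeq_infinite_Field[OF _ that card_of_Card_order] inf
    by (simp add: Field_card_of)
  have "|{r}| \<le>o |?U|" using fin by simp
  moreover have "|x ` verts G| \<le>o |?U|" using card_of_image v ordLeq_transitive by blast
  moreover have "|y ` edges G| \<le>o |?U|" using card_of_image e ordLeq_transitive by blast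
  ultimately have "|{r} \<union> (x ` verts G \<union> y ` edges G)| \<le>o |?U|"
    by (intro Un)
  then have "|N| \<le>o |?U|" by (simp add: N_def)
  moreover have "\<forall>n\<in>N. |set (W n)| \<le>o |?U|"
    using fin by simp
  ultimately have "|S| \<le>o |?U|"
    unfolding S_def by (rule card_of_UNION_ordLeq_infinite[OF inf])
  then obtain f :: "_ \<Rightarrow> 'a + nat" where "inj_on f S"
    using card_of_ordLeq[of S ?U] by auto
  with conS ST tdS show ?thesis by blast
qed

end

lemma treewidth_leI:
  assumes "simple_graph G" "tree_decomposition G T B" "width_at_most T B k"
  shows "treewidth G \<le> enat k"
proof -
  obtain S and f :: "_ \<Rightarrow> 'a + nat" where S: "S \<subseteq> verts T"
    "tree_decomposition G (induced_subgraph T S) B" "inj_on f S"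
    using tree_decomposition_small[OF assms(1,2)] by auto
  let ?T = "induced_subgraph T S"
  have verts: "verts ?T = S" using S(1) by (auto simp: induced_subgraph_def)
  have "tree_decomposition G (map_graph f ?T) (\<lambda>y. B (inv_into (verts ?T) f y))"
    using tree_decomposition_map_graph[OF S(2)] S(3) verts by simp
  moreover have "width_at_most (map_graph f ?T) (\<lambda>y. B (inv_into (verts ?T) f y)) k"
    using assms(3) S verts by (auto simp: width_at_most_def map_graph_def)
  ultimately show ?thesis unfolding treewidth_def by (intro Inf_lower) blast
qed

lemma treewidth_leD:
  fixes G :: "'a graph"
  assumes "treewidth G \<le> enat k"
  shows "\<exists>(T :: ('a + nat) graph) B. tree_decomposition G T B \<and> width_at_most T B k"
proof -
  let ?A = "{enat k | k. \<exists>(T :: ('a + nat) graph) B. tree_decomposition G T B \<and> width_at_most T B k}"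
  have "?A \<noteq> {}"
  proof
    assume "?A = {}"
    then have "treewidth G = \<infinity>" unfolding treewidth_def by (simp only: Inf_empty top_enat_def)
    then show False using assms by simp
  qed
  then have "treewidth G \<in> ?A"
    unfolding treewidth_def by (metis (lifting) equals0I wellorder_InfI)
  then show ?thesis using assms by (force simp: width_at_most_def)
qed

end

theory Submission
  imports Defs
begin

text \<open>Let \<open>R = \<lfloor>2 c\<rfloor>\<close>, so that adjacent vertices of \<open>G\<close> are mapped to vertices of \<open>H\<close> at distance
  at most \<open>R\<close>. The vertices of \<open>H\<close> are labelled in rounds. In an even round every component of the
  unlabelled part of \<open>H\<close> receives a new class, consisting of one vertex that is topmost in a rooted
  tree-decomposition of \<open>H\<close>. As classes stay connected, a component is adjacent to at most \<open>k\<close>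
  classes. In an odd round, if a component has just been cut off from a class \<open>L\<close>, then
  its vertices from which \<open>L\<close> can be reached within distance \<open>R\<close>, leaving the component through a
  class \<open>M\<close> younger than \<open>L\<close>, are absorbed by \<open>M\<close>. Each absorption by \<open>M\<close> is charged to one of
  the at most \<open>k\<close> classes that are older than \<open>M\<close> and visible at the birth of \<open>M\<close>, so classes have
  radius at most \<open>k R\<close>.

  Finally a vertex \<open>u\<close> is assigned to the oldest class within distance \<open>R\<close> that is still
  remembered when \<open>u\<close> is labelled. If \<open>u\<close> and \<open>v\<close> are at distance at most \<open>R\<close>, then both are
  assigned to classes that exist when the first vertex of a shortest path between them is labelled,
  hence to classes remembered by one component. So the parts have diameter at most \<open>2 (k + 1) R\<close> in
  \<open>H\<close>, and the remembered classes, of which there are at most \<open>k + 1\<close>, are the bags of a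
  tree-decomposition of the quotient.\<close>

subsection \<open>Rooted trees\<close>

text \<open>The set \<open>N\<close> may be infinite. Since \<open>rk\<close> drops along
  \<open>par\<close>, every upward path is finite, and this also excludes cycles.\<close>

locale parent_tree =
  fixes N :: "'t set" and r :: 't and par :: "'t \<Rightarrow> 't" and rk :: "'t \<Rightarrow> nat"
  assumes root: "r \<in> N"
    and par: "\<And>x. x \<in> N \<Longrightarrow> x \<noteq> r \<Longrightarrow> par x \<in> N"
    and rk: "\<And>x. x \<in> N \<Longrightarrow> x \<noteq> r \<Longrightarrow> rk (par x) < rk x"
begin

definition T :: "'t graph" where
  "T = \<lparr>verts = N, edges = {{x, par x} | x. x \<in> N \<and> x \<noteq> r}\<rparr>"

lemma verts_T: "verts T = N" and edges_T: "edges T = {{x, par x} | x. x \<in> N \<and> x \<noteq> r}"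
  by (simp_all add: T_def)

lemma path_to_top:
  assumes "S \<subseteq> N" "s \<in> S"
    and top: "\<And>x. x \<in> S \<Longrightarrow> x \<noteq> s \<Longrightarrow> x \<noteq> r \<and> par x \<in> S"
    and "x \<in> S"
  shows "\<exists>p. walk T p \<and> hd p = x \<and> last p = s \<and> set p \<subseteq> S"
  using \<open>x \<in> S\<close>
proof (induction "rk x" arbitrary: x rule: less_induct)
  case less
  show ?case
  proof (cases "x = s")
    case True
    then show ?thesis using assms verts_T by (intro exI[of _ "[x]"]) auto
  next
    case False
    with less.prems top have x: "x \<noteq> r" "par x \<in> S" "x \<in> N" using assms(1) by auto
    then obtain p where p: "walk T p" "hd p = par x" "last p = s" "set p \<subseteq> S"
      using less.hyps rk by blast
    then have "p \<noteq> []" by (auto simp: walk_def)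
    have "{x, par x} \<in> edges T" using x edges_T by blast
    then have "walk T ([x] @ p)"
      using p x verts_T \<open>p \<noteq> []\<close> by (subst walk_append_iff) auto
    then show ?thesis using p \<open>p \<noteq> []\<close> less.prems by (intro exI[of _ "[x] @ p"]) auto
  qed
qed

lemma connected_subtree:
  assumes "S \<subseteq> N" "s \<in> S"
    and "\<And>x. x \<in> S \<Longrightarrow> x \<noteq> s \<Longrightarrow> x \<noteq> r \<and> par x \<in> S"
  shows "connected_graph (induced_subgraph T S)"
  unfolding connected_graph_def
proof (intro conjI ballI)
  show "verts (induced_subgraph T S) \<noteq> {}"
    using assms verts_T by (auto simp: induced_subgraph_def)
next
  fix u v assume "u \<in> verts (induced_subgraph T S)" "v \<in> verts (induced_subgraph T S)"
  then have "u \<in> S" "v \<in> S" by (auto simp: induced_subgraph_def)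
  then obtain p q where p: "walk T p" "hd p = u" "last p = s" "set p \<subseteq> S"
    and q: "walk T q" "hd q = v" "last q = s" "set q \<subseteq> S"
    using path_to_top[OF assms] by meson
  have "q \<noteq> []" using q by (auto simp: walk_def)
  with p q show "\<exists>p. walk (induced_subgraph T S) p \<and> hd p = u \<and> last p = v"
    using walk_join[of T p "rev q"]
    by (auto simp: walk_rev last_rev hd_rev walk_induced_subgraph)
qed

text \<open>On a cycle, both neighbours of a vertex of maximal rank would have to be its
  parent.\<close>

lemma tree_T: "tree T"
  unfolding tree_def
proof (intro conjI notI)
  show "simple_graph T"
    unfolding simple_graph_def using par rk verts_T edges_T by fastforce
  have "induced_subgraph T N = T"
    using par by (auto simp: induced_subgraph_def T_def)
  then show "connected_graph T"
    using connected_subtree[of N r] root par by auto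
next
  assume "\<exists>p. cycle T p"
  then obtain p where p: "walk T p" "distinct p" "3 \<le> length p" "{last p, hd p} \<in> edges T"
    by (auto simp: cycle_def)
  then have "finite (rk ` set p)" "rk ` set p \<noteq> {}" by auto
  then obtain x where x: "x \<in> set p" "rk x = Max (rk ` set p)" using Max_in by (metis imageE)
  then have max: "rk y \<le> rk x" if "y \<in> set p" for y using that by simp
  obtain p1 p2 where pp: "p = p1 @ x # p2" using x(1) by (meson split_list)
  have nb: "y = par x" if "{x, y} \<in> edges T" "y \<in> set p" for y
  proof -
    obtain z where z: "{x, y} = {z, par z}" "z \<in> N" "z \<noteq> r" using \<open>{x, y} \<in> edges T\<close> edges_T by auto
    then have "rk (par z) < rk z" using rk by blast
    moreover have "rk y \<le> rk x" using max that by blast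
    ultimately show ?thesis using z(1) by (auto simp: doubleton_eq_iff)
  qed
  \<comment> \<open>The cycle is cut open at \<open>x\<close>, so the two ends of \<open>q\<close>
    are the neighbours of \<open>x\<close>.\<close>
  define q where "q = p2 @ p1"
  have q: "2 \<le> length q" "distinct q" "set q \<subseteq> set p" using p pp by (auto simp: q_def)
  have "{x, hd q} \<in> edges T"
  proof (cases "p2 = []")
    case True
    then show ?thesis using p pp by (cases p1) (auto simp: q_def)
  next
    case False
    then show ?thesis using p pp
      by (cases p2) (auto simp: q_def walk_def successively_append_iff successively_Cons)
  qed
  moreover have "{x, last q} \<in> edges T"
  proof (cases "p1 = []")
    case True
    then show ?thesis using p pp by (cases p2 rule: rev_cases) (auto simp: q_def insert_commute)
  next
    case False
    then show ?thesis using p pp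
      by (auto simp: q_def walk_def successively_append_iff successively_Cons insert_commute)
  qed
  moreover have "hd q \<in> set p" "last q \<in> set p" using q by (cases q; force)+
  ultimately have "hd q = last q" using nb by metis
  moreover obtain a b q' where "q = a # b # q'" using q(1) by (metis Suc_le_length_iff numeral_2_eq_2)
  ultimately show False using q(2) by (auto split: if_splits)
qed
end

section \<open>Descendants and depth in a tree with a chosen root\<close>

definition adjacency :: "'a graph \<Rightarrow> 'a rel" where
  "adjacency G = {(u, v). {u, v} \<in> edges G}"

lemma walk_leaves:
  assumes "walk G p" "hd p \<in> P" "last p \<notin> P"
  shows "\<exists>a b. a \<in> set p \<and> b \<in> set p \<and> a \<in> P \<and> b \<notin> P \<and> {a, b} \<in> edges G"
proof -
  have "\<exists>y\<in>set p. y \<notin> P" using assms(1,3) by (force simp: walk_def)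
  then obtain p1 b p2 where p: "p = p1 @ b # p2" "b \<notin> P" "\<forall>y\<in>set p1. \<not> y \<notin> P"
    by (rule split_list_first_propE)
  then have "p1 \<noteq> []" using assms(2) by auto
  then have "{last p1, b} \<in> edges G" "last p1 \<in> set p1"
    using assms(1) p by (auto simp: walk_def successively_append_iff)
  then show ?thesis using p by auto
qed

context
  fixes T :: "'t graph" and r :: 't
  assumes T: "tree T" and r: "r \<in> verts T"
begin

definition rooted_walk :: "'t \<Rightarrow> 't list \<Rightarrow> bool" where
  "rooted_walk x p \<longleftrightarrow> walk T p \<and> hd p = r \<and> last p = x"

text \<open>Vertices are counted, not edges, so the root has depth 1.\<close>

definition depth :: "'t \<Rightarrow> nat" where
  "depth x = (LEAST n. \<exists>p. rooted_walk x p \<and> length p = n)"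

definition below :: "'t \<Rightarrow> 't set" where
  "below y = {x \<in> verts T. \<forall>p. rooted_walk x p \<longrightarrow> y \<in> set p}"

lemma rooted_walk_ex: "x \<in> verts T \<Longrightarrow> \<exists>p. rooted_walk x p"
  using T r by (auto simp: rooted_walk_def tree_def connected_graph_def)

lemma depth_le: "rooted_walk x p \<Longrightarrow> depth x \<le> length p"
  unfolding depth_def by (rule Least_le) blast

lemma depth_walk:
  assumes "x \<in> verts T"
  obtains p where "rooted_walk x p" "length p = depth x"
  using LeastI_ex[of "\<lambda>n. \<exists>p. rooted_walk x p \<and> length p = n"] rooted_walk_ex[OF assms]
  unfolding depth_def[symmetric] by blast

lemma rooted_walk_prefix:
  assumes "rooted_walk x (p1 @ y # p2)"
  shows "rooted_walk y (p1 @ [y])"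
  using assms by (auto simp: rooted_walk_def walk_def successively_append_iff successively_Cons hd_append)

lemma depth_below:
  assumes "x \<in> below y" "x \<noteq> y"
  shows "depth y < depth x"
proof -
  have "x \<in> verts T" using assms by (auto simp: below_def)
  then obtain p where p: "rooted_walk x p" "length p = depth x" by (rule depth_walk)
  then have "y \<in> set p" using assms by (auto simp: below_def)
  then obtain p1 p2 where pp: "p = p1 @ y # p2" by (meson split_list)
  then have "depth y \<le> length (p1 @ [y])" using p rooted_walk_prefix depth_le by blast
  moreover have "p2 \<noteq> []" using p pp assms(2) by (auto simp: rooted_walk_def)
  ultimately show ?thesis using p pp by (cases p2) auto
qed

text \<open>A walk from the root to \<open>x'\<close> that avoids \<open>y\<close> can be extended
  by \<open>x\<close>; as it must then contain \<open>y\<close>, this vertex is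
  \<open>x\<close>.\<close>

lemma below_leave:
  assumes "x \<in> below y" "x' \<in> verts T" "x' \<notin> below y" "{x, x'} \<in> edges T"
  shows "x = y"
proof -
  obtain p where p: "rooted_walk x' p" "y \<notin> set p" using assms by (auto simp: below_def)
  have "x \<in> verts T" using assms by (auto simp: below_def)
  then have "rooted_walk x (p @ [x])"
    using p assms
    by (auto simp: rooted_walk_def walk_def successively_append_iff insert_commute)
  then show ?thesis using assms(1) p by (auto simp: below_def)
qed

text \<open>The last vertex but one on a shortest walk from the root to \<open>y\<close> is
  \<open>x'\<close>: otherwise two walks that avoid \<open>y\<close> join these neighbours of
  \<open>y\<close> and close a cycle through \<open>y\<close>.\<close>

lemma depth_parent:
  assumes "y \<in> verts T" "x' \<in> verts T" "x' \<notin> below y" "{y, x'} \<in> edges T"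
  shows "depth x' < depth y"
proof -
  obtain p where p: "rooted_walk x' p" "y \<notin> set p" using assms by (auto simp: below_def)
  obtain q where q: "rooted_walk y q" "length q = depth y" using assms(1) by (rule depth_walk)
  have "q \<noteq> []" using q by (auto simp: rooted_walk_def walk_def)
  then obtain q1 where q1: "q = q1 @ [y]"
    using q by (metis append_butlast_last_id rooted_walk_def)
  have "y \<noteq> r" using p by (auto simp: rooted_walk_def walk_def)
  then have "q1 \<noteq> []" using q q1 by (auto simp: rooted_walk_def)
  have w: "rooted_walk (last q1) q1" "{last q1, y} \<in> edges T"
    using q q1 \<open>q1 \<noteq> []\<close> by (auto simp: rooted_walk_def walk_def successively_append_iff)
  have "y \<notin> set q1"
  proof
    assume "y \<in> set q1"
    then obtain a b where "q1 = a @ y # b" by (meson split_list)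
    then have "rooted_walk y (a @ [y])" "length (a @ [y]) < length q"
      using w(1) rooted_walk_prefix q1 by auto
    then show False using depth_le q(2) by fastforce
  qed
  show ?thesis
  proof (cases "last q1 = x'")
    case True
    then show ?thesis using depth_le w(1) q q1 by fastforce
  next
    case False
    have "p \<noteq> []" using p by (auto simp: rooted_walk_def walk_def)
    have "\<exists>s. walk T s \<and> hd s = last q1 \<and> last s = x' \<and> set s \<subseteq> set q1 \<union> set p"
      using walk_join[of T "rev q1" p] w(1) p \<open>p \<noteq> []\<close> \<open>q1 \<noteq> []\<close>
      by (auto simp: rooted_walk_def walk_rev last_rev hd_rev)
    then obtain s where s: "walk T s" "distinct s" "hd s = last q1" "last s = x'" "y \<notin> set s"
      using walk_distinct p(2) \<open>y \<notin> set q1\<close> by (metis UnE subsetD)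
    have "s \<noteq> []" using s by (auto simp: walk_def)
    then have "2 \<le> length s" using s False by (cases s; cases "tl s") auto
    moreover have "walk T ([y] @ s)"
      using s w(2) assms \<open>s \<noteq> []\<close> by (subst walk_append_iff) (auto simp: insert_commute)
    ultimately have "cycle T ([y] @ s)"
      using s assms \<open>s \<noteq> []\<close> by (auto simp: cycle_def insert_commute)
    then show ?thesis using T by (auto simp: tree_def)
  qed
qed

end

subsection \<open>Labelling the vertices in rounds\<close>

text \<open>A label consists of the round in which its class is born and of the first vertex of the class.\<close>

type_synonym 'b label = "nat \<times> 'b"

definition unlabelled :: "'b rel \<Rightarrow> ('b \<Rightarrow> 'b label option) \<Rightarrow> 'b rel" where
  "unlabelled E lam = {(a, b) \<in> E. lam a = None \<and> lam b = None}"

definition component :: "'b rel \<Rightarrow> ('b \<Rightarrow> 'b label option) \<Rightarrow> 'b \<Rightarrow> 'b set" where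
  "component E lam u = (unlabelled E lam)\<^sup>* `` {u}"

definition seen :: "'b rel \<Rightarrow> ('b \<Rightarrow> 'b label option) \<Rightarrow> 'b \<Rightarrow> 'b label set" where
  "seen E lam u = {L. \<exists>x\<in>component E lam u. \<exists>w. (x, w) \<in> E \<and> lam w = Some L}"

text \<open>In \<open>exit_within\<close> and \<open>reaches\<close>, \<open>C\<close> is the set of the classes that have been cut off, \<open>w\<close> is the first
  labelled vertex on a walk from \<open>u\<close>, and \<open>m\<close> is the length of the whole walk.\<close>

definition exit_within ::
  "'b rel \<Rightarrow> ('b \<Rightarrow> 'b label option) \<Rightarrow> 'b label set \<Rightarrow> nat \<Rightarrow> 'b \<Rightarrow> bool" where
  "exit_within E lam C q w \<longleftrightarrow>
     (\<exists>M L y. lam w = Some M \<and> L \<in> C \<and> fst L < fst M \<and> (w, y) \<in> E ^^ q \<and> lam y = Some L)"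

definition reaches ::
  "'b rel \<Rightarrow> ('b \<Rightarrow> 'b label option) \<Rightarrow> 'b label set \<Rightarrow> nat \<Rightarrow> 'b \<Rightarrow> bool" where
  "reaches E lam C m u \<longleftrightarrow>
     (\<exists>p q x w. lam u = None \<and> (u, x) \<in> unlabelled E lam ^^ p \<and> (x, w) \<in> E \<and>
        exit_within E lam C q w \<and> m = Suc (p + q))"

lemma unlabelled_sym: "sym E \<Longrightarrow> sym (unlabelled E lam)"
  by (auto simp: unlabelled_def sym_def)

lemma component_self [simp]: "u \<in> component E lam u"
  by (simp add: component_def)

lemma component_eq: "sym E \<Longrightarrow> v \<in> component E lam u \<Longrightarrow> component E lam v = component E lam u"
  unfolding component_def using sym_rtrancl[OF unlabelled_sym[of E lam]]
  by (auto dest: symD intro: rtrancl_trans)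

lemma seen_eq: "sym E \<Longrightarrow> v \<in> component E lam u \<Longrightarrow> seen E lam v = seen E lam u"
  unfolding seen_def by (simp add: component_eq)

lemma component_None:
  assumes "v \<in> component E lam u" "lam u = None"
  shows "lam v = None"
proof -
  have "(u, v) \<in> (unlabelled E lam)\<^sup>*" using assms by (simp add: component_def)
  then show ?thesis using assms(2) by induction (auto simp: unlabelled_def)
qed

lemma component_step:
  "v \<in> component E lam u \<Longrightarrow> (v, w) \<in> E \<Longrightarrow> lam v = None \<Longrightarrow> lam w = None \<Longrightarrow> w \<in> component E lam u"
  by (auto simp: component_def unlabelled_def intro: rtrancl_into_rtrancl)

lemma component_antimono:
  assumes "\<And>x. lam' x = None \<Longrightarrow> lam x = None"
  shows "component E lam' u \<subseteq> component E lam u"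
proof -
  have "unlabelled E lam' \<subseteq> unlabelled E lam" using assms by (auto simp: unlabelled_def)
  then show ?thesis unfolding component_def using rtrancl_mono by blast
qed

text \<open>The walk is split at its first labelled vertex \<open>w\<close>, in the form demanded by
  \<open>reaches\<close>.\<close>

lemma first_labelled:
  assumes "(u, y) \<in> E ^^ i" "lam u = None" "lam y \<noteq> None"
  shows "\<exists>p q x w. (u, x) \<in> unlabelled E lam ^^ p \<and> (x, w) \<in> E \<and> lam w \<noteq> None \<and>
    (w, y) \<in> E ^^ q \<and> i = Suc (p + q)"
  using assms
proof (induction i arbitrary: u)
  case (Suc i)
  obtain v where v: "(u, v) \<in> E" "(v, y) \<in> E ^^ i" using Suc.prems(1) relpow_Suc_D2 by metis
  show ?case
  proof (cases "lam v")
    case None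
    then obtain p q x w where "(v, x) \<in> unlabelled E lam ^^ p" "(x, w) \<in> E" "lam w \<noteq> None"
      "(w, y) \<in> E ^^ q" "i = Suc (p + q)" using Suc v by blast
    moreover have "(u, v) \<in> unlabelled E lam" using None Suc.prems v by (simp add: unlabelled_def)
    ultimately show ?thesis
      by (intro exI[of _ "Suc p"] exI[of _ q] exI[of _ x] exI[of _ w])
        (auto intro: relpow_Suc_I2 simp del: relpow.simps)
  next
    case (Some a)
    then show ?thesis using v
      by (intro exI[of _ 0] exI[of _ i] exI[of _ u] exI[of _ v]) auto
  qed
qed simp

lemma unlabelled_pow_comp: "(u, x) \<in> unlabelled E lam ^^ p \<Longrightarrow> x \<in> component E lam u"
  unfolding component_def using relpow_imp_rtrancl by fastforce

text \<open>The demands on an odd round, where \<open>C u\<close> holds the classes from which the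
  component of \<open>u\<close> has been cut off. The requirement \<open>fst L < fst M\<close>
  supplies the older class to which an absorption is charged, and the last line keeps classes
  connected.\<close>

definition absorbs :: "'b rel \<Rightarrow> nat \<Rightarrow> ('b \<Rightarrow> 'b label option) \<Rightarrow> ('b \<Rightarrow> 'b label set) \<Rightarrow>
    ('b \<Rightarrow> 'b label option) \<Rightarrow> bool" where
  "absorbs E R lam C lam' \<longleftrightarrow>
     (\<forall>u L. lam u = Some L \<longrightarrow> lam' u = Some L) \<and>
     (\<forall>u m. m \<le> R \<longrightarrow> reaches E lam (C u) m u \<longrightarrow> lam' u \<noteq> None) \<and>
     (\<forall>u M. lam u = None \<longrightarrow> lam' u = Some M \<longrightarrow>
       (\<exists>L\<in>C u. fst L < fst M) \<and>
       (\<exists>p x w. (u, x) \<in> unlabelled E lam ^^ p \<and> (x, w) \<in> E \<and> lam w = Some M \<and> Suc p \<le> R \<and>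
          (u, w) \<in> {(a, b) \<in> E. lam' a = Some M \<and> lam' b = Some M}\<^sup>*))"

text \<open>Moving along shortest walks lowers \<open>\<delta>\<close> and so arrives at a labelled
  vertex after at most \<open>R\<close> steps. Constancy of \<open>C\<close> on components ensures
  that the rest of a shortest walk counts for its next vertex too.\<close>

lemma absorbs_ex:
  assumes sym: "sym E" and C: "\<And>u v. lam u = None \<Longrightarrow> v \<in> component E lam u \<Longrightarrow> C v = C u"
  shows "\<exists>lam'. absorbs E R lam C lam'"
proof -
  \<comment> \<open>Every absorbed vertex copies the label of the next vertex on a shortest walk; this keeps
    classes connected.\<close>
  define \<delta> where "\<delta> u = (LEAST m. reaches E lam (C u) m u)" for u
  define A where "A = {u. \<exists>m\<le>R. reaches E lam (C u) m u}"
  have A_None: "lam u = None" if "u \<in> A" for u using that by (auto simp: A_def reaches_def)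
  have \<delta>_le: "\<delta> u \<le> m" if "reaches E lam (C u) m u" for u m
    unfolding \<delta>_def using that by (rule Least_le)
  have \<delta>_R: "\<delta> u \<le> R" if "u \<in> A" for u
    using that \<delta>_le unfolding A_def by (blast intro: order_trans)
  define nx where "nx u x \<longleftrightarrow> (u, x) \<in> E \<and> (if lam x = None then x \<in> A \<and> \<delta> x < \<delta> u \<and> x \<in> component E lam u
      else \<exists>q. exit_within E lam (C u) q x \<and> \<delta> u = Suc q)" for u x
  have "\<exists>x. nx u x" if u: "u \<in> A" for u
  proof -
    have "reaches E lam (C u) (\<delta> u) u"
      unfolding \<delta>_def using u by (auto simp: A_def intro: LeastI)
    then obtain p q x w where r: "lam u = None" "(u, x) \<in> unlabelled E lam ^^ p" "(x, w) \<in> E"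
      "exit_within E lam (C u) q w" "\<delta> u = Suc (p + q)"
      by (auto simp: reaches_def)
    show ?thesis
    proof (cases p)
      case 0
      then show ?thesis using r by (intro exI[of _ w]) (auto simp: exit_within_def nx_def)
    next
      case (Suc p')
      then obtain v where v: "(u, v) \<in> unlabelled E lam" "(v, x) \<in> unlabelled E lam ^^ p'"
        using r(2) relpow_Suc_D2 by metis
      then have vN: "lam v = None" "(u, v) \<in> E" by (auto simp: unlabelled_def)
      have vc: "v \<in> component E lam u" using v by (auto simp: component_def)
      then have "C v = C u" using C r by blast
      then have "reaches E lam (C v) (Suc (p' + q)) v"
        using v vN r unfolding reaches_def by metis
      moreover have "Suc (p' + q) \<le> R" using \<delta>_R[OF u] r Suc by simp
      ultimately have "v \<in> A" "\<delta> v < \<delta> u"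
        using \<delta>_le[of v] r Suc by (auto simp: A_def less_eq_Suc_le)
      then show ?thesis using vN vc by (auto simp: nx_def)
    qed
  qed
  then have "\<forall>u\<in>A. \<exists>x. nx u x" by blast
  then obtain nxt where "\<forall>u\<in>A. nx u (nxt u)" using bchoice by blast
  then have nxt: "\<And>u. u \<in> A \<Longrightarrow> (u, nxt u) \<in> E \<and>
    (if lam (nxt u) = None then nxt u \<in> A \<and> \<delta> (nxt u) < \<delta> u \<and> nxt u \<in> component E lam u
      else \<exists>q. exit_within E lam (C u) q (nxt u) \<and> \<delta> u = Suc q)"
    unfolding nx_def by blast
  \<comment> \<open>Outside \<open>A\<close> the map is stationary, so that \<open>R\<close>
    iterations from any vertex of \<open>A\<close> end at a labelled vertex, however short the
    walk.\<close>
  define g where "g = (\<lambda>u. if u \<in> A then nxt u else u)"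
  have g_fix: "(g ^^ n) u = u" if "u \<notin> A" for n u
    using that by (induction n) (auto simp: g_def)
  have reach_lab: "(g ^^ n) u \<notin> A" if "\<delta> u \<le> n" "u \<in> A" for n u
    using that
  proof (induction n arbitrary: u)
    case 0
    then obtain m where "reaches E lam (C u) m u" by (auto simp: A_def)
    then have "reaches E lam (C u) (\<delta> u) u" unfolding \<delta>_def by (rule LeastI)
    then have "reaches E lam (C u) 0 u" using 0 by simp
    then show ?case by (simp add: reaches_def)
  next
    case (Suc n)
    have "(g ^^ Suc n) u = (g ^^ n) (nxt u)"
      using Suc.prems by (simp add: funpow_swap1 g_def del: funpow.simps(2) add: funpow_Suc_right)
    moreover have "(g ^^ n) (nxt u) \<notin> A"
    proof (cases "nxt u \<in> A")
      case True
      then have "\<delta> (nxt u) < \<delta> u" using nxt[OF Suc.prems(2)] A_None by simp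
      then show ?thesis using Suc.IH True Suc.prems(1) by simp
    qed (simp add: g_fix)
    ultimately show ?case by simp
  qed
  define h where "h u = lam ((g ^^ R) u)" for u
  have h_nxt: "h (nxt u) = h u" if "u \<in> A" for u
  proof -
    have "(g ^^ R) u \<notin> A" using reach_lab \<delta>_R that by blast
    moreover have "(g ^^ R) (nxt u) = g ((g ^^ R) u)"
      using that by (metis (full_types) funpow_swap1 g_def)
    ultimately show ?thesis by (simp add: h_def g_def)
  qed
  define lam' where "lam' u = (if u \<in> A then h u else lam u)" for u
  have main: "\<exists>M. h u = Some M \<and> (\<exists>L\<in>C u. fst L < fst M) \<and>
       (\<exists>p x w. (u, x) \<in> unlabelled E lam ^^ p \<and> (x, w) \<in> E \<and> lam w = Some M \<and> Suc p \<le> \<delta> u \<and>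
          (u, w) \<in> {(a, b) \<in> E. lam' a = Some M \<and> lam' b = Some M}\<^sup>*)"
    if "u \<in> A" for u
    using that
  proof (induction "\<delta> u" arbitrary: u rule: less_induct)
    case less
    note n = nxt[OF less.prems]
    have "lam u = None" using A_None less.prems by blast
    show ?case
    proof (cases "lam (nxt u)")
      case None
      then have v: "nxt u \<in> A" "\<delta> (nxt u) < \<delta> u" "nxt u \<in> component E lam u" "(u, nxt u) \<in> E"
        using n by auto
      have "C (nxt u) = C u" using C \<open>lam u = None\<close> v by blast
      obtain M p x w where M: "h (nxt u) = Some M" "\<exists>L\<in>C (nxt u). fst L < fst M"
        "(nxt u, x) \<in> unlabelled E lam ^^ p" "(x, w) \<in> E" "lam w = Some M" "Suc p \<le> \<delta> (nxt u)"
        "(nxt u, w) \<in> {(a, b) \<in> E. lam' a = Some M \<and> lam' b = Some M}\<^sup>*"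
        using less.hyps[OF v(2,1)] by blast
      have hu: "h u = Some M" using M h_nxt less.prems by simp
      have "(u, nxt u) \<in> {(a, b) \<in> E. lam' a = Some M \<and> lam' b = Some M}"
        using v M hu less.prems by (simp add: lam'_def)
      then have "(u, w) \<in> {(a, b) \<in> E. lam' a = Some M \<and> lam' b = Some M}\<^sup>*"
        using M(7) by (rule converse_rtrancl_into_rtrancl)
      moreover have "(u, x) \<in> unlabelled E lam ^^ Suc p"
        using M(3) v None \<open>lam u = None\<close> by (intro relpow_Suc_I2) (auto simp: unlabelled_def)
      moreover have "Suc (Suc p) \<le> \<delta> u" using M v by simp
      moreover have "\<exists>L\<in>C u. fst L < fst M" using M(2) \<open>C (nxt u) = C u\<close> by simp
      ultimately show ?thesis using M(4,5) hu by blast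
    next
      case (Some M)
      then have "\<exists>q. exit_within E lam (C u) q (nxt u) \<and> \<delta> u = Suc q" using n by simp
      then obtain q where q: "exit_within E lam (C u) q (nxt u)" "\<delta> u = Suc q" by blast
      have "nxt u \<notin> A" using Some A_None by force
      then have "h (nxt u) = Some M" using Some by (simp add: h_def g_fix)
      then have hu: "h u = Some M" using h_nxt less.prems by simp
      have "(u, nxt u) \<in> {(a, b) \<in> E. lam' a = Some M \<and> lam' b = Some M}"
        using n Some hu less.prems \<open>nxt u \<notin> A\<close> by (simp add: lam'_def)
      moreover have "\<exists>L\<in>C u. fst L < fst M" using q(1) Some unfolding exit_within_def by (metis option.inject)
      moreover have "(u, u) \<in> unlabelled E lam ^^ 0" "(u, nxt u) \<in> E" "Suc 0 \<le> \<delta> u"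
        using n q by simp_all
      ultimately show ?thesis using hu Some by blast
    qed
  qed
  have 1: "lam' u = Some L" if "lam u = Some L" for u L
      using that A_None by (auto simp: lam'_def)
  have 2: "lam' u \<noteq> None" if "m \<le> R" "reaches E lam (C u) m u" for u m
      using that main[of u] by (auto simp: lam'_def A_def)
  have 3: "(\<exists>L\<in>C u. fst L < fst M) \<and>
       (\<exists>p x w. (u, x) \<in> unlabelled E lam ^^ p \<and> (x, w) \<in> E \<and> lam w = Some M \<and> Suc p \<le> R \<and>
          (u, w) \<in> {(a, b) \<in> E. lam' a = Some M \<and> lam' b = Some M}\<^sup>*)"
      if "lam u = None" "lam' u = Some M" for u M
    proof -
      have u: "u \<in> A" "h u = Some M" using that by (auto simp: lam'_def split: if_splits)
      obtain p x w where "(u, x) \<in> unlabelled E lam ^^ p" "(x, w) \<in> E" "lam w = Some M"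
        "Suc p \<le> \<delta> u" "(u, w) \<in> {(a, b) \<in> E. lam' a = Some M \<and> lam' b = Some M}\<^sup>*"
        and L: "\<exists>L\<in>C u. fst L < fst M"
        using main[OF u(1)] u(2) by auto
      moreover have "Suc p \<le> R" using \<delta>_R[OF u(1)] \<open>Suc p \<le> \<delta> u\<close> by simp
      ultimately show ?thesis by blast
    qed
  have "absorbs E R lam C lam'" unfolding absorbs_def using 1 2 3 by blast
  then show ?thesis by blast
qed

section \<open>Vertices within a bounded number of steps\<close>

definition near :: "'b rel \<Rightarrow> nat \<Rightarrow> 'b \<Rightarrow> 'b \<Rightarrow> bool" where
  "near E d x y \<longleftrightarrow> (\<exists>i\<le>d. (x, y) \<in> E ^^ i)"

lemma near_refl [simp]: "near E d x x"
  unfolding near_def by (rule exI[of _ 0]) auto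

lemma near_mono: "near E d x y \<Longrightarrow> d \<le> e \<Longrightarrow> near E e x y"
  unfolding near_def using order_trans by blast

lemma near_trans: "near E d x y \<Longrightarrow> near E e y z \<Longrightarrow> near E (d + e) x z"
  unfolding near_def by (metis add_mono relcompI relpow_add)

lemma relpow_sym: "sym E \<Longrightarrow> (x, y) \<in> E ^^ i \<Longrightarrow> (y, x) \<in> E ^^ i"
proof (induction i arbitrary: y)
  case (Suc i)
  then obtain z where "(x, z) \<in> E ^^ i" "(z, y) \<in> E" by auto
  then have "(z, x) \<in> E ^^ i" "(y, z) \<in> E" using Suc by (auto dest: symD)
  then show ?case by (rule relpow_Suc_I2[rotated])
qed auto

lemma near_sym: "sym E \<Longrightarrow> near E d x y \<Longrightarrow> near E d y x"
  unfolding near_def using relpow_sym[of E x y] by metis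

lemma unlabelled_pow: "(u, x) \<in> unlabelled E lam ^^ p \<Longrightarrow> (u, x) \<in> E ^^ p"
  by (induction p arbitrary: x) (auto simp: unlabelled_def)

text \<open>What is used of a rooted tree-decomposition of width at most \<open>k\<close>:
  \<open>lv x\<close> is the depth of the topmost node whose bag contains \<open>x\<close>, and
  \<open>bag x\<close> is that bag. By \<open>reach\<close>, an exploration from \<open>x\<close>
  through levels no smaller than \<open>lv x\<close> meets level \<open>lv x\<close> or smaller only
  in \<open>bag x\<close>.\<close>

locale layered =
  fixes V :: "'b set" and E :: "'b rel" and lv :: "'b \<Rightarrow> nat" and bag :: "'b \<Rightarrow> 'b set"
    and k R :: nat
  assumes sym: "sym E" and E_V: "E \<subseteq> V \<times> V"
    and bag: "\<And>x. x \<in> V \<Longrightarrow> x \<in> bag x \<and> finite (bag x) \<and> card (bag x) \<le> k + 1"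
    and reach: "\<And>x y z. \<lbrakk>x \<in> V; (x, y) \<in> {(a, b) \<in> E. lv x \<le> lv a \<and> lv x \<le> lv b}\<^sup>*;
       (y, z) \<in> E; lv z \<le> lv x\<rbrakk> \<Longrightarrow> z \<in> bag x"
begin

text \<open>Depends on the set alone, so all vertices of a component agree on the chosen
  vertex.\<close>

definition pick :: "'b set \<Rightarrow> 'b" where
  "pick S = (SOME z. z \<in> S \<and> (\<forall>x\<in>S. lv z \<le> lv x))"

lemma pick: "u \<in> S \<Longrightarrow> pick S \<in> S \<and> (\<forall>x\<in>S. lv (pick S) \<le> lv x)"
  unfolding pick_def
  using someI_ex[of "\<lambda>z. z \<in> S \<and> (\<forall>x\<in>S. lv z \<le> lv x)"] ex_has_least_nat[of "\<lambda>z. z \<in> S" u lv]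
  by blast

text \<open>The second component of the state is the set of classes remembered by each component: it may
  contain classes from which the component has been cut off since the last odd round.\<close>

primrec state :: "nat \<Rightarrow> ('b \<Rightarrow> 'b label option) \<times> ('b \<Rightarrow> 'b label set)" where
  "state 0 = (\<lambda>_. None, \<lambda>_. {})"
| "state (Suc n) = (case state n of (lam, memory) \<Rightarrow>
     if even n then
       (\<lambda>u. if u \<in> V \<and> lam u = None \<and> pick (component E lam u) = u then Some (n, u) else lam u,
        \<lambda>u. insert (n, pick (component E lam u)) (memory u))
     else (SOME lam'. absorbs E R lam (\<lambda>u. memory u - seen E lam u) lam', seen E lam))"

definition lam :: "nat \<Rightarrow> 'b \<Rightarrow> 'b label option" where "lam n = fst (state n)"
definition memory :: "nat \<Rightarrow> 'b \<Rightarrow> 'b label set" where "memory n = snd (state n)"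

abbreviation "cm n u \<equiv> component E (lam n) u"
abbreviation "sn n u \<equiv> seen E (lam n) u"

section \<open>Persistence of labels and of memory\<close>

lemma lam_0: "lam 0 u = None" and memory_0: "memory 0 u = {}"
  by (simp_all add: lam_def memory_def)

lemma lam_even: "even n \<Longrightarrow> lam (Suc n) u =
    (if u \<in> V \<and> lam n u = None \<and> pick (cm n u) = u then Some (n, u) else lam n u)"
  and memory_even: "even n \<Longrightarrow> memory (Suc n) u = insert (n, pick (cm n u)) (memory n u)"
  and memory_odd: "odd n \<Longrightarrow> memory (Suc n) u = sn n u"
  by (simp_all add: lam_def memory_def case_prod_beta)

lemma lam_odd: "odd n \<Longrightarrow>
    lam (Suc n) = (SOME lam'. absorbs E R (lam n) (\<lambda>u. memory n u - sn n u) lam')"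
  by (simp add: lam_def memory_def case_prod_beta)

text \<open>Components only shrink, so vertices of one component have always been together and carry
  the same history.\<close>

lemma memory_const: "lam n u = None \<Longrightarrow> v \<in> cm n u \<Longrightarrow> memory n v = memory n u"
proof (induction n arbitrary: u v)
  case 0
  then show ?case by (simp add: memory_0)
next
  case (Suc n)
  \<comment> \<open>In an odd round labels persist because \<open>absorbs\<close> can be satisfied,
    and this rests on the induction hypothesis; hence persistence is proved inside the
    induction.\<close>
  have mono: "lam n x = None" if "lam (Suc n) x = None" for x
  proof (cases "even n")
    case False
    have "\<exists>lam'. absorbs E R (lam n) (\<lambda>u. memory n u - sn n u) lam'"
    proof (rule absorbs_ex[OF sym])
      fix u v assume a: "lam n u = None" "v \<in> cm n u"
      show "memory n v - sn n v = memory n u - sn n u" using Suc.IH[OF a] seen_eq[OF sym a(2)] by simp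
    qed
    then have "absorbs E R (lam n) (\<lambda>u. memory n u - sn n u) (lam (Suc n))"
      unfolding lam_odd[OF False] by (rule someI_ex)
    then show ?thesis using that unfolding absorbs_def by (metis not_Some_eq)
  qed (use that in \<open>simp add: lam_even split: if_splits\<close>)
  have v: "v \<in> cm n u" "lam n u = None"
    using Suc.prems component_antimono[of "lam (Suc n)" "lam n" E u] mono by auto
  then show ?case
    using Suc.IH[OF v(2,1)] component_eq[OF sym v(1)] seen_eq[OF sym v(1)]
    by (cases "even n") (simp_all add: memory_even memory_odd)
qed

lemma absorbs_odd:
  assumes "odd n" shows "absorbs E R (lam n) (\<lambda>u. memory n u - sn n u) (lam (Suc n))"
proof -
  have "\<exists>lam'. absorbs E R (lam n) (\<lambda>u. memory n u - sn n u) lam'"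
  proof (rule absorbs_ex[OF sym])
    fix u v assume a: "lam n u = None" "v \<in> cm n u"
    show "memory n v - sn n v = memory n u - sn n u" using memory_const[OF a] seen_eq[OF sym a(2)] by simp
  qed
  then show ?thesis unfolding lam_odd[OF assms] by (rule someI_ex)
qed

lemma lam_Suc: "lam n u = Some L \<Longrightarrow> lam (Suc n) u = Some L"
proof (cases "even n")
  case False
  then show ?thesis if "lam n u = Some L" using absorbs_odd that unfolding absorbs_def by blast
qed (simp add: lam_even)

lemma lam_mono: "lam n u = Some L \<Longrightarrow> n \<le> m \<Longrightarrow> lam m u = Some L"
  using lift_Suc_mono_le[of "\<lambda>i. lam i u = Some L" n m] lam_Suc by (auto simp: le_bool_def)

lemma lam_None_mono: "lam m u = None \<Longrightarrow> n \<le> m \<Longrightarrow> lam n u = None"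
  using lam_mono by (metis not_Some_eq)

lemma cm_mono: "n \<le> m \<Longrightarrow> cm m u \<subseteq> cm n u"
  by (rule component_antimono) (rule lam_None_mono)

lemma new_even: "even n \<Longrightarrow> lam n u = None \<Longrightarrow> lam (Suc n) u = Some L \<Longrightarrow>
    u \<in> V \<and> L = (n, u) \<and> pick (cm n u) = u"
  by (auto simp: lam_even split: if_splits)

lemma new_odd:
  assumes "odd n" "lam n u = None" "lam (Suc n) u = Some M"
  shows "\<exists>L\<in>memory n u - sn n u. fst L < fst M"
    and "\<exists>p x w. (u, x) \<in> unlabelled E (lam n) ^^ p \<and> (x, w) \<in> E \<and> lam n w = Some M \<and> Suc p \<le> R \<and>
       (u, w) \<in> {(a, b) \<in> E. lam (Suc n) a = Some M \<and> lam (Suc n) b = Some M}\<^sup>*"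
  using absorbs_odd[OF assms(1)] assms(2,3) unfolding absorbs_def by blast+

lemma new_odd_seen:
  assumes "odd n" "lam n u = None" "lam (Suc n) u = Some M"
  shows "M \<in> sn n u"
  using new_odd(2)[OF assms] unlabelled_pow_comp unfolding seen_def by fastforce

lemma lam_fst: "lam n v = Some L \<Longrightarrow> fst L < n"
proof (induction n arbitrary: v L)
  case (Suc n)
  show ?case
  proof (cases "lam n v")
    case None
    show ?thesis
    proof (cases "even n")
      case False
      then obtain w where "lam n w = Some L" using new_odd(2)[OF False None Suc.prems] by blast
      then show ?thesis using Suc.IH less_SucI by blast
    next
      case True
      then show ?thesis using new_even[OF True None Suc.prems] by simp
    qed
  next
    case (Some L')
    then have "lam n v = Some L" using Suc.prems lam_Suc[OF Some] by simp
    then show ?thesis using Suc.IH less_SucI by blast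
  qed
qed (simp add: lam_0)

lemma label_time:
  assumes "lam n w = Some L"
  shows "\<exists>m<n. lam m w = None \<and> lam (Suc m) w = Some L"
  using assms
proof (induction n)
  case (Suc n)
  show ?case
  proof (cases "lam n w")
    case (Some M)
    then have "lam n w = Some L" using Suc.prems lam_Suc[OF Some] by simp
    then show ?thesis using Suc.IH less_SucI by blast
  qed (use Suc.prems in blast)
qed (simp add: lam_0)

section \<open>Connectedness of the classes\<close>

abbreviation "cls n L \<equiv> {(a, b) \<in> E. lam n a = Some L \<and> lam n b = Some L}"

text \<open>A class starts in an even round with the topmost vertex of a component, and an odd round
  only adds vertices that are joined to it inside the class.\<close>

lemma centre:
  assumes "lam n w = Some (m, z)"
  shows "even m \<and> z \<in> V \<and> pick (cm m z) = z \<and> lam m z = None \<and> lam (Suc m) z = Some (m, z) \<and>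
    lam m w = None \<and> (w, z) \<in> (cls n (m, z))\<^sup>*"
  using assms
proof (induction n arbitrary: w)
  case (Suc n)
  have sub: "(cls n (m, z))\<^sup>* \<subseteq> (cls (Suc n) (m, z))\<^sup>*"
    by (rule rtrancl_mono) (auto intro: lam_Suc)
  show ?case
  proof (cases "lam n w")
    case (Some L)
    then have "lam n w = Some (m, z)" using Suc.prems lam_Suc[OF Some] by simp
    then show ?thesis using Suc.IH sub by blast
  next
    case None
    show ?thesis
    proof (cases "even n")
      case True
      then show ?thesis using new_even[OF True None Suc.prems] None Suc.prems by auto
    next
      case False
      then obtain y where y: "lam n y = Some (m, z)" "(w, y) \<in> (cls (Suc n) (m, z))\<^sup>*"
        using new_odd(2)[OF False None Suc.prems] by blast
      have "m \<le> n" using lam_fst[OF y(1)] by simp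
      then have "lam m w = None" using None lam_None_mono by blast
      moreover have "(w, z) \<in> (cls (Suc n) (m, z))\<^sup>*"
        using y(2) Suc.IH[OF y(1)] sub by (blast intro: rtrancl_trans)
      ultimately show ?thesis using Suc.IH[OF y(1)] by blast
    qed
  qed
qed (simp add: lam_0)

text \<open>At the birth of a class all its later members are still unlabelled, so the connected
  class lies in one component.\<close>

lemma class_comp:
  assumes "lam n w = Some (m, z)" shows "w \<in> cm m z"
proof -
  have "cls n (m, z) \<subseteq> unlabelled E (lam m)"
  proof clarify
    fix a b assume "(a, b) \<in> E" "lam n a = Some (m, z)" "lam n b = Some (m, z)"
    then show "(a, b) \<in> unlabelled E (lam m)"
      using centre[of n a m z] centre[of n b m z] by (simp add: unlabelled_def)
  qed
  then have "(cls n (m, z))\<^sup>* \<subseteq> (unlabelled E (lam m))\<^sup>*" by (rule rtrancl_mono)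
  moreover have "(w, z) \<in> (cls n (m, z))\<^sup>*" using centre[OF assms] by simp
  ultimately have "(w, z) \<in> (unlabelled E (lam m))\<^sup>*" by (rule subsetD)
  then have "(z, w) \<in> (unlabelled E (lam m))\<^sup>*"
    using sym_rtrancl[OF unlabelled_sym[OF sym]] by (auto dest: symD)
  then show ?thesis by (simp add: component_def)
qed

lemma cm_V:
  assumes "u \<in> V" shows "cm n u \<subseteq> V"
proof
  fix x assume "x \<in> cm n u"
  then have "(u, x) \<in> (unlabelled E (lam n))\<^sup>*" by (simp add: component_def)
  then show "x \<in> V" by (cases rule: rtranclE) (use assms E_V in \<open>auto simp: unlabelled_def\<close>)
qed

text \<open>A class that has been forgotten never becomes adjacent again: a neighbour labelled in
  this round was in the component before, and its label is the newborn one or one already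
  seen.\<close>

lemma seen_memory: "lam n u = None \<Longrightarrow> sn n u \<subseteq> memory n u"
proof (induction n arbitrary: u)
  case 0
  then show ?case by (auto simp: seen_def lam_0)
next
  case (Suc n)
  have u: "lam n u = None" using Suc.prems lam_None_mono le_SucI by blast
  show ?case
  proof
    fix L assume "L \<in> sn (Suc n) u"
    then obtain x w where x: "x \<in> cm (Suc n) u" "(x, w) \<in> E" "lam (Suc n) w = Some L"
      by (auto simp: seen_def)
    then have xn: "x \<in> cm n u" "lam n x = None"
      using cm_mono[of n "Suc n"] component_None u by fastforce+
    show "L \<in> memory (Suc n) u"
    proof (cases "lam n w")
      case (Some L')
      then have "lam n w = Some L" using x(3) lam_Suc[OF Some] by simp
      then have "L \<in> sn n u" using x(2) xn unfolding seen_def by blast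
      then show ?thesis using Suc.IH[OF u] by (cases "even n") (auto simp: memory_even memory_odd)
    next
      case None
      then have w: "w \<in> cm n u" using component_step[OF xn(1) x(2) xn(2)] by blast
      show ?thesis
      proof (cases "even n")
        case True
        then show ?thesis using new_even[OF True None x(3)] component_eq[OF sym w] by (auto simp: memory_even)
      next
        case False
        then show ?thesis using new_odd_seen[OF False None x(3)] seen_eq[OF sym w] by (simp add: memory_odd)
      qed
    qed
  qed
qed

lemma sn_fst: "L \<in> sn n u \<Longrightarrow> fst L < n"
  unfolding seen_def using lam_fst by blast

lemma memory_fst: "L \<in> memory n u \<Longrightarrow> fst L < n"
proof (induction n)
  case (Suc n)
  then show ?case using sn_fst by (cases "even n") (auto simp: memory_even memory_odd less_Suc_eq)
qed (simp add: memory_0)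

text \<open>All that is remembered in round \<open>n\<close>: in an even round the newborn class is
  included, in an odd round the classes about to be forgotten still are.\<close>

definition Bag :: "nat \<Rightarrow> 'b \<Rightarrow> 'b label set" where
  "Bag n u = (if even n then insert (n, pick (cm n u)) (memory n u) else memory n u)"

lemma memory_Bag: "memory n u \<subseteq> Bag n u"
  by (auto simp: Bag_def)

lemma memory_Suc_sub: "lam n u = None \<Longrightarrow> memory (Suc n) u \<subseteq> Bag n u"
  using seen_memory by (auto simp: Bag_def memory_even memory_odd)

lemma Bag_less: "L \<in> Bag n u \<Longrightarrow> fst L < n \<Longrightarrow> L \<in> memory n u"
  by (auto simp: Bag_def split: if_splits)

text \<open>Only newborn classes enter the memory, so an older class that is remembered now was
  remembered at all times since its birth.\<close>

lemma memory_back: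
  assumes "L \<in> memory n u" "fst L < m" "m \<le> n" "lam n u = None"
  shows "L \<in> memory m u"
  using assms
proof (induction n)
  case (Suc n)
  show ?case
  proof (cases "m = Suc n")
    case False
    have "lam n u = None" using Suc.prems lam_None_mono le_SucI by blast
    then have "L \<in> Bag n u" using memory_Suc_sub Suc.prems by blast
    then show ?thesis using False Suc Bag_less \<open>lam n u = None\<close> by simp
  qed (use Suc in simp)
qed simp

lemma Bag_back:
  assumes "L \<in> Bag n u" "fst L \<le> m" "m \<le> n" "lam n u = None"
  shows "L \<in> Bag m u"
proof (cases "m = n")
  case False
  then have "L \<in> memory n u" using assms Bag_less by simp
  then have "L \<in> memory (Suc m) u" using memory_back[of L n u "Suc m"] assms False by simp
  moreover have "lam m u = None" using assms lam_None_mono by blast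
  ultimately show ?thesis using memory_Suc_sub by blast
qed (use assms in simp)

lemma Bag_const: "lam n u = None \<Longrightarrow> v \<in> cm n u \<Longrightarrow> Bag n v = Bag n u"
  using memory_const[of n u v] component_eq[OF sym, of v "lam n" u] by (simp add: Bag_def)

text \<open>The centre of a seen class is at a level no larger than that of the topmost vertex
  \<open>x0\<close> of the component, as it was chosen from a component containing
  \<open>x0\<close>. Hence the connected class meets \<open>bag x0\<close>, and distinct classes
  meet it in distinct vertices.\<close>

lemma seen_card:
  assumes "u \<in> V" "lam n u = None"
  shows "finite (sn n u) \<and> card (sn n u) \<le> k"
proof -
  define x0 where "x0 = pick (cm n u)"
  define rel where "rel = {(a, b) \<in> E. lv x0 \<le> lv a \<and> lv x0 \<le> lv b}"
  have x0: "x0 \<in> cm n u" "\<And>x. x \<in> cm n u \<Longrightarrow> lv x0 \<le> lv x"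
    using pick[of u "cm n u"] by (auto simp: x0_def)
  have x0V: "x0 \<in> V" and x0N: "lam n x0 = None"
    using x0(1) cm_V[OF assms(1)] component_None[of x0 E "lam n" u] assms(2) by blast+
  have eq: "cm n x0 = cm n u" using component_eq[OF sym x0(1)] .
  have in_rel: "(x0, x) \<in> rel\<^sup>*" if "x \<in> cm n u" for x
  proof -
    have "(x0, x) \<in> (unlabelled E (lam n))\<^sup>*" using that eq by (auto simp: component_def)
    then show ?thesis
    proof induction
      case (step a b)
      then have "a \<in> cm n x0" "b \<in> cm n x0" by (auto simp: component_def intro: rtrancl_into_rtrancl)
      then have "(a, b) \<in> rel" using step x0 eq by (auto simp: rel_def unlabelled_def)
      then show ?case using step by auto
    qed simp
  qed
  have rel_lv: "lv x0 \<le> lv x" if "(x0, x) \<in> rel\<^sup>*" for x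
    using that by (cases rule: rtranclE) (auto simp: rel_def)
  have hit: "\<exists>v\<in>bag x0. lam n v = Some L" if L0: "L \<in> sn n u" for L
  proof -
    obtain m z where L: "L = (m, z)" by fastforce
    obtain x w where x: "x \<in> cm n u" "(x, w) \<in> E" "lam n w = Some (m, z)"
      using L0 L unfolding seen_def by blast
    have "m \<le> n" using lam_fst[OF x(3)] by simp
    note c = centre[OF x(3)]
    have w: "w \<in> cm m z" using class_comp x by blast
    have "lam n x = None" using component_None[OF x(1) assms(2)] .
    then have "lam m x = None" using lam_None_mono \<open>m \<le> n\<close> by blast
    moreover have "(w, x) \<in> E" using x(2) sym by (blast dest: symD)
    ultimately have "x \<in> cm m z" using component_step[OF w] c by blast
    then have "cm m x = cm m z" by (rule component_eq[OF sym])
    moreover have "cm n x = cm n u" using x(1) by (rule component_eq[OF sym])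
    ultimately have "cm n u \<subseteq> cm m z" using cm_mono[OF \<open>m \<le> n\<close>, of x] by simp
    then have "x0 \<in> cm m z" using x0(1) by blast
    then have lvz: "lv z \<le> lv x0" using c pick[of z "cm m z"] by simp
    have reach': "b \<in> bag x0" if "(x0, a) \<in> rel\<^sup>*" "(a, b) \<in> E" "lv b \<le> lv x0" for a b
      using reach[OF x0V, folded rel_def] that by blast
    have zL: "lam n z = Some (m, z)" using c lam_mono lam_fst[OF x(3)] by (metis Suc_leI fst_conv)
    \<comment> \<open>The class is followed from \<open>w\<close> to its centre until the level
      first drops to that of \<open>x0\<close> or below; \<open>reach\<close> puts this vertex into
      \<open>bag x0\<close>.\<close>
    have "(x0, x) \<in> rel\<^sup>* \<Longrightarrow> (x, w) \<in> E \<Longrightarrow> \<exists>v\<in>bag x0. lam n v = Some (m, z)"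
      if "(w, z) \<in> (cls n (m, z))\<^sup>*" for x w
      using that
    proof (induction arbitrary: x rule: converse_rtrancl_induct)
      case base
      then have "z \<in> bag x0" using reach' lvz by blast
      then show ?case using zL by blast
    next
      case (step w w')
      show ?case
      proof (cases "lv w \<le> lv x0")
        case True
        then have "w \<in> bag x0" using reach' step.prems by blast
        moreover have "lam n w = Some (m, z)" using step.hyps(1) by simp
        ultimately show ?thesis by blast
      next
        case False
        then have "(x, w) \<in> rel" 
          using step.prems(2) rel_lv[OF step.prems(1)] unfolding rel_def by simp
        with step.prems(1) have "(x0, w) \<in> rel\<^sup>*" by (rule rtrancl_into_rtrancl)
        moreover have "(w, w') \<in> E" using step.hyps(1) by simp
        ultimately show ?thesis by (rule step.IH)
      qed
    qed
    then show ?thesis using c x(2) in_rel[OF x(1)] L by blast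
  qed
  \<comment> \<open>The vertex \<open>x0\<close> of its own bag is unlabelled, which improves
    \<open>k + 1\<close> to \<open>k\<close>.\<close>
  have sub: "sn n u \<subseteq> (\<lambda>v. the (lam n v)) ` (bag x0 - {x0})"
  proof
    fix L assume "L \<in> sn n u"
    then obtain v where "v \<in> bag x0" "lam n v = Some L" using hit by blast
    then show "L \<in> (\<lambda>v. the (lam n v)) ` (bag x0 - {x0})" using x0N by force
  qed
  have fin: "finite (bag x0 - {x0})" and "card (bag x0 - {x0}) \<le> k" using bag[OF x0V] by auto
  moreover have "card (sn n u) \<le> card (bag x0 - {x0})" using fin sub by (rule surj_card_le)
  moreover have "finite (sn n u)" using sub fin finite_subset by blast
  ultimately show ?thesis by simp
qed

text \<open>The preceding odd round has pruned the memory to the seen classes; in round 0 it is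
  empty.\<close>

lemma memory_card:
  assumes "u \<in> V" "lam n u = None" "even n"
  shows "finite (memory n u) \<and> card (memory n u) \<le> k"
proof (cases n)
  case (Suc m)
  have "odd m" using assms(3) Suc by simp
  moreover have "lam m u = None" using lam_None_mono[OF assms(2), of m] Suc by simp
  ultimately show ?thesis using seen_card[OF assms(1), of m] Suc by (simp add: memory_odd)
qed (simp add: memory_0)

text \<open>One newborn class is added to at most \<open>k\<close> remembered ones, and the
  following odd round has the same bag.\<close>

lemma Bag_card:
  assumes "u \<in> V" "lam n u = None"
  shows "finite (Bag n u) \<and> card (Bag n u) \<le> k + 1"
proof -
  have ev: "finite (insert L (memory m u)) \<and> card (insert L (memory m u)) \<le> k + 1"
    if "even m" "lam m u = None" for m L
    using memory_card[OF assms(1) that(2,1)] by (simp add: card_insert_if)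
  show ?thesis
  proof (cases "even n")
    case False
    then obtain m where m: "n = Suc m" "even m" by (cases n) auto
    have "lam m u = None" using lam_None_mono[OF assms(2), of m] m(1) by simp
    then show ?thesis using ev[OF m(2)] m False by (simp add: Bag_def memory_even)
  next
    case True
    then show ?thesis using ev[OF True assms(2)] by (simp add: Bag_def)
  qed
qed

text \<open>The bound counts the classes remembered at the birth of the class that the component of
  \<open>v\<close> no longer sees. If \<open>v\<close> copies its label from an absorbed vertex
  \<open>w\<close> at distance at most \<open>R\<close>, this count is larger for \<open>v\<close>
  than for \<open>w\<close>, because the class \<open>L0\<close> that caused the absorption of
  \<open>v\<close> was still seen when \<open>w\<close> was absorbed.\<close>

lemma radius:
  assumes "lam n v = None" "lam (Suc n) v = Some (m, z)"
  shows "near E (R * card {L \<in> memory m z. L \<notin> sn n v}) z v"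
  using assms
proof (induction n arbitrary: v rule: less_induct)
  case (less n)
  show ?case
  proof (cases "even n")
    case True
    then show ?thesis using new_even[OF True less.prems] by simp
  next
    case False
    obtain L0 where L0: "L0 \<in> memory n v" "L0 \<notin> sn n v" "fst L0 < m"
      using new_odd(1)[OF False less.prems] by auto
    obtain p x w where w: "(v, x) \<in> unlabelled E (lam n) ^^ p" "(x, w) \<in> E"
      "lam n w = Some (m, z)" "Suc p \<le> R"
      using new_odd(2)[OF False less.prems] by blast
    obtain n1 where n1: "n1 < n" "lam n1 w = None" "lam (Suc n1) w = Some (m, z)"
      using label_time[OF w(3)] by blast
    have "m \<le> n1" using lam_fst[OF n1(3)] by simp
    have vN: "lam n1 v = None" using lam_None_mono[OF less.prems(1)] n1(1) by simp
    have mN: "lam m v = None" using lam_None_mono[OF vN \<open>m \<le> n1\<close>] .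
    have x: "x \<in> cm n v" using unlabelled_pow_comp[OF w(1)] .
    have "x \<in> cm n1 v" using cm_mono[of n1 n v] x n1(1) by auto
    moreover from this have "lam n1 x = None" using component_None[of x E "lam n1" v] vN by simp
    ultimately have wc: "w \<in> cm n1 v" using component_step w(2) n1(2) by metis
    have sn_w: "sn n1 w = sn n1 v" using seen_eq[OF sym wc] .
    note c = centre[OF w(3)]
    have "v \<in> cm m z" using class_comp[OF less.prems(2)] .
    then have memory_v: "memory m v = memory m z" using memory_const[of m z v] c by simp
    have near_v: "near E R w v"
    proof -
      have "(v, w) \<in> E ^^ Suc p" using unlabelled_pow[OF w(1)] w(2) by auto
      then have "(w, v) \<in> E ^^ Suc p" using relpow_sym[OF sym] by blast
      then show ?thesis using w(4) unfolding near_def by blast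
    qed
    let ?A = "{L \<in> memory m z. L \<notin> sn n v}"
    have fin: "finite (memory m z)" using memory_card[of z m] c by simp
    have L0m: "L0 \<in> memory m z"
      using memory_back[OF L0(1,3) _ less.prems(1)] \<open>m \<le> n1\<close> n1(1) memory_v by simp
    show ?thesis
    proof (cases "even n1")
      case True
      then have "w = z" using new_even[OF True n1(2,3)] by simp
      have "?A \<noteq> {}" using L0m L0(2) by blast
      then have "1 \<le> card ?A" using fin by (simp add: Suc_leI card_gt_0_iff)
      then have "R \<le> R * card ?A" by simp
      then show ?thesis using near_mono[OF near_v] \<open>w = z\<close> by simp
    next
      case odd: False
      let ?A1 = "{L \<in> memory m z. L \<notin> sn n1 w}"
      \<comment> \<open>A class born before round \<open>m\<close> and remembered in round
        \<open>n\<close> has survived the pruning in round \<open>n1\<close>, so it was seen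
        then.\<close>
      have older: "L \<in> sn n1 v" if "L \<in> memory n v" "fst L < m" for L
        using memory_back[OF that(1) _ _ less.prems(1), of "Suc n1"] that(2) \<open>m \<le> n1\<close> n1(1) memory_odd[OF odd]
        by simp
      have "?A1 \<subseteq> ?A"
      proof clarify
        fix L :: "'b label"
        assume L: "L \<in> memory m z" "L \<notin> sn n1 w" "L \<in> sn n v"
        then have "L \<in> sn n1 v"
          using older[of L] seen_memory[OF less.prems(1)] memory_fst[OF L(1)] by blast
        then show False using L(2) sn_w by simp
      qed
      moreover have "L0 \<in> ?A - ?A1" using L0m L0(2) older[OF L0(1,3)] sn_w by simp
      ultimately have "?A1 \<subset> ?A" by blast
      then have "Suc (card ?A1) \<le> card ?A" using fin by (simp add: Suc_leI psubset_card_mono)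
      then have le: "R * card ?A1 + R \<le> R * card ?A"
        using mult_le_mono2[of "Suc (card ?A1)" "card ?A" R] by simp
      have "near E (R * card ?A1) z w" using less.IH[OF n1] .
      then show ?thesis using near_mono[OF near_trans[OF _ near_v] le] by blast
    qed
  qed
qed

lemma radius_le:
  assumes "lam n v = Some (m, z)"
  shows "near E (R * k) z v"
proof -
  obtain i where i: "lam i v = None" "lam (Suc i) v = Some (m, z)" using label_time[OF assms] by blast
  note c = centre[OF assms]
  have fin: "finite (memory m z)" "card (memory m z) \<le> k" using memory_card[of z m] c by simp_all
  have "card {L \<in> memory m z. L \<notin> sn i v} \<le> card (memory m z)" by (rule card_mono) (use fin in auto)
  then have "R * card {L \<in> memory m z. L \<notin> sn i v} \<le> R * k" using fin by simp
  then show ?thesis using near_mono[OF radius[OF i]] by blast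
qed

text \<open>Otherwise the component of \<open>v\<close> loses a new topmost vertex in each even
  round. Their levels are at most \<open>lv v\<close>, so infinitely many share a level, and
  \<open>reach\<close> puts these into the bag of the first of them, which is finite.\<close>

lemma eventually_labelled:
  assumes v: "v \<in> V" shows "\<exists>n. lam n v \<noteq> None"
proof (rule ccontr)
  assume "\<not> ?thesis"
  then have N: "lam n v = None" for n by blast
  define f where "f j = pick (cm (2 * j) v)" for j
  have f_cm: "f j \<in> cm (2 * j) v" and f_min: "x \<in> cm (2 * j) v \<Longrightarrow> lv (f j) \<le> lv x" for j x
    using pick[of v "cm (2 * j) v"] by (auto simp: f_def)
  have f_V: "f j \<in> V" for j using f_cm cm_V[OF v] by blast
  have f_N: "lam (2 * j) (f j) = None" for j using component_None[OF f_cm] N by simp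
  have f_eq: "cm (2 * j) (f j) = cm (2 * j) v" for j using component_eq[OF sym f_cm] .
  have f_lab: "lam (Suc (2 * j)) (f j) = Some (2 * j, f j)" for j
    using lam_even[of "2 * j" "f j"] f_V f_N f_eq f_def by simp
  have neq: "f i \<noteq> f j" if "i < j" for i j
  proof
    assume "f i = f j"
    then have "lam (2 * j) (f j) \<noteq> None"
      using lam_mono[OF f_lab[of i], of "2 * j"] that by simp
    then show False using f_N by simp
  qed
  then have inj: "inj f" by (metis injI linorder_neqE_nat)
  have "range (\<lambda>j. lv (f j)) \<subseteq> {..lv v}" using f_min by auto
  then have "finite (range (\<lambda>j. lv (f j)))" using finite_subset by blast
  then obtain j where "infinite {a \<in> UNIV. lv (f a) = lv (f j)}"
    using pigeonhole_infinite[of UNIV "\<lambda>j. lv (f j)"] by auto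
  then have inf: "infinite {a. lv (f a) = lv (f j)}" by simp
  define j0 where "j0 = (LEAST a. lv (f a) = lv (f j))"
  have j0: "lv (f j0) = lv (f j)" unfolding j0_def by (rule LeastI) simp
  have "f a \<in> bag (f j0)" if a: "lv (f a) = lv (f j)" for a
  proof (cases "a = j0")
    case True
    then show ?thesis using bag f_V by blast
  next
    case False
    moreover have "j0 \<le> a" unfolding j0_def using a by (rule Least_le)
    ultimately have "j0 < a" by simp
    define rel where "rel = {(x, y) \<in> E. lv (f j0) \<le> lv x \<and> lv (f j0) \<le> lv y}"
    have "f a \<in> cm (2 * j0) v" using f_cm[of a] cm_mono[of "2 * j0" "2 * a" v] \<open>j0 < a\<close> by auto
    then have "f a \<in> cm (2 * j0) (f j0)" using f_eq by simp
    then have "(f j0, f a) \<in> (unlabelled E (lam (2 * j0)))\<^sup>*" by (simp add: component_def)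
    moreover have "f j0 \<noteq> f a" using neq \<open>j0 < a\<close> by blast
    ultimately obtain y where y: "(f j0, y) \<in> (unlabelled E (lam (2 * j0)))\<^sup>*"
      "(y, f a) \<in> unlabelled E (lam (2 * j0))" by (metis rtranclE)
    have "(f j0, y) \<in> rel\<^sup>*" using y(1)
    proof induction
      case (step b c)
      have "b \<in> cm (2 * j0) (f j0)" "c \<in> cm (2 * j0) (f j0)"
        using step.hyps by (auto simp: component_def intro: rtrancl_into_rtrancl)
      then have "lv (f j0) \<le> lv b" "lv (f j0) \<le> lv c" using f_min[of _ j0] f_eq by simp_all
      then have "(b, c) \<in> rel" using step.hyps(2) by (simp add: rel_def unlabelled_def)
      with step.IH show ?case by (rule rtrancl_into_rtrancl)
    qed simp
    moreover have "(y, f a) \<in> E" using y(2) by (simp add: unlabelled_def)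
    moreover have "lv (f a) \<le> lv (f j0)" using a j0 by simp
    ultimately show ?thesis by (rule reach[OF f_V[of j0], folded rel_def])
  qed
  then have "f ` {a. lv (f a) = lv (f j)} \<subseteq> bag (f j0)" by auto
  then have "finite (f ` {a. lv (f a) = lv (f j)})" using bag f_V finite_subset by metis
  then show False using inf inj by (meson finite_imageD inj_on_subset subset_UNIV)
qed

section \<open>Assignment of the vertices to classes\<close>

definition \<tau> :: "'b \<Rightarrow> nat" where "\<tau> v = (LEAST n. lam (Suc n) v \<noteq> None)"

lemma \<tau>:
  assumes "v \<in> V"
  shows \<tau>_None: "lam (\<tau> v) v = None" and \<tau>_Some: "lam (Suc (\<tau> v)) v \<noteq> None"
proof -
  have "\<exists>n. lam (Suc n) v \<noteq> None"
    using eventually_labelled[OF assms] lam_Suc by (metis not_Some_eq)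
  then show "lam (Suc (\<tau> v)) v \<noteq> None" unfolding \<tau>_def by (rule LeastI_ex)
  show "lam (\<tau> v) v = None"
  proof (cases "\<tau> v")
    case (Suc n)
    then have "n < (LEAST n. lam (Suc n) v \<noteq> None)" by (simp add: \<tau>_def)
    then have "\<not> lam (Suc n) v \<noteq> None" by (rule not_less_Least)
    then have "lam (Suc n) v = None" by blast
    then show ?thesis using Suc by simp
  qed (simp add: lam_0)
qed

lemma None_le_\<tau>: "v \<in> V \<Longrightarrow> n \<le> \<tau> v \<Longrightarrow> lam n v = None"
  using \<tau>_None lam_None_mono by blast

lemma le_\<tau>: "v \<in> V \<Longrightarrow> lam n v = None \<Longrightarrow> n \<le> \<tau> v"
  using \<tau>_Some lam_None_mono by (metis not_less_eq_eq)

text \<open>The round \<open>n\<close> is free: the vertex \<open>x\<close> may join the class after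
  \<open>u\<close> has been labelled.\<close>

definition candidates :: "'b \<Rightarrow> 'b label set" where
  "candidates u = {L \<in> Bag (\<tau> u) u. \<exists>x n. near E R u x \<and> lam n x = Some L}"

text \<open>A label seen from the component of \<open>u\<close> and close to \<open>u\<close> is replaced, once it is cut off from
  the component, by the first label met on the way to it: that label is older, as otherwise
  \<open>u\<close> would have been absorbed.\<close>

lemma candidate_memory:
  assumes u: "u \<in> V" and v: "near E R u v" "lam (Suc t) v \<noteq> None"
    and n: "Suc t \<le> n" "n \<le> \<tau> u"
  shows "\<exists>L\<in>memory n u. fst L \<le> t \<and> (\<exists>x. near E R u x \<and> lam n x = Some L)"
  using n
proof (induction n rule: dec_induct)
  case base
  have uN: "lam (Suc t) u = None" using None_le_\<tau>[OF u base] .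
  obtain i where i: "i \<le> R" "(u, v) \<in> E ^^ i" using v(1) by (auto simp: near_def)
  obtain p q x w where w: "(u, x) \<in> unlabelled E (lam (Suc t)) ^^ p" "(x, w) \<in> E"
    "lam (Suc t) w \<noteq> None" "i = Suc (p + q)"
    using first_labelled[where lam = "lam (Suc t)", OF i(2) uN v(2)] by blast
  then obtain L where L: "lam (Suc t) w = Some L" by blast
  have "L \<in> sn (Suc t) u" using unlabelled_pow_comp[OF w(1)] w(2) L unfolding seen_def by blast
  then have "L \<in> memory (Suc t) u" using seen_memory[OF uN] by blast
  moreover have "fst L \<le> t" using lam_fst[OF L] by simp
  moreover have "(u, w) \<in> E ^^ Suc p" using unlabelled_pow[OF w(1)] w(2) by auto
  then have "near E R u w" unfolding near_def using i(1) w(4) by (metis Suc_leI le_add1 le_trans not_less_eq_eq)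
  ultimately show ?case using L by blast
next
  case (step n)
  then obtain L x where L: "L \<in> memory n u" "fst L \<le> t" "near E R u x" "lam n x = Some L"
    using Suc_leD by blast
  have uN: "lam n u = None" "lam (Suc n) u = None" using None_le_\<tau>[OF u] step.prems by simp_all
  show ?case
  proof (cases "even n")
    case True
    then show ?thesis using L lam_Suc[OF L(4)] memory_even[OF True, of u] by blast
  next
    case False
    show ?thesis
    proof (cases "L \<in> sn n u")
      case True
      then show ?thesis using L lam_Suc[OF L(4)] memory_odd[OF False, of u] by blast
    next
      case cut: False
      obtain i where i: "i \<le> R" "(u, x) \<in> E ^^ i" using L(3) by (auto simp: near_def)
      obtain p q y w where w: "(u, y) \<in> unlabelled E (lam n) ^^ p" "(y, w) \<in> E"
        "lam n w \<noteq> None" "(w, x) \<in> E ^^ q" "i = Suc (p + q)"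
        using first_labelled[where lam = "lam n", OF i(2) uN(1)] L(4) by blast
      then obtain M where M: "lam n w = Some M" by blast
      have "M \<in> sn n u" using unlabelled_pow_comp[OF w(1)] w(2) M unfolding seen_def by blast
      then have "M \<in> memory (Suc n) u" using memory_odd[OF False] by simp
      moreover have "(u, w) \<in> E ^^ Suc p" using unlabelled_pow[OF w(1)] w(2) by auto
      then have "near E R u w" unfolding near_def using i(1) w(5) by (metis Suc_leI le_add1 le_trans not_less_eq_eq)
      moreover have "fst M \<le> fst L"
      proof (rule ccontr)
        assume "\<not> ?thesis"
        then have "exit_within E (lam n) (memory n u - sn n u) q w"
          unfolding exit_within_def using M L(1,4) cut w(4) by (meson DiffI not_le)
        then have "reaches E (lam n) (memory n u - sn n u) i u"
          unfolding reaches_def using w uN(1) by blast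
        then show False using absorbs_odd[OF False] i(1) uN(2) unfolding absorbs_def by blast
      qed
      ultimately show ?thesis using L(2) lam_Suc[OF M] by (meson le_trans)
    qed
  qed
qed

text \<open>If \<open>u\<close> and \<open>v\<close> are labelled in the same round, the label of
  \<open>u\<close> itself will do; otherwise a candidate is handed on from the round in which
  \<open>v\<close> is labelled.\<close>

lemma candidate:
  assumes u: "u \<in> V" and v: "v \<in> V" "near E R u v" "\<tau> v \<le> \<tau> u"
  shows "\<exists>L\<in>candidates u. fst L \<le> \<tau> v"
proof (cases "\<tau> v = \<tau> u")
  case True
  note n = \<tau>_None[OF u]
  obtain L where L: "lam (Suc (\<tau> u)) u = Some L" using \<tau>_Some[OF u] by blast
  have "L \<in> Bag (\<tau> u) u"
  proof (cases "even (\<tau> u)")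
    case even: True
    then show ?thesis using new_even[OF even n L] by (simp add: Bag_def)
  next
    case False
    then show ?thesis using new_odd_seen[OF False n L] seen_memory[OF n] by (auto simp: Bag_def)
  qed
  then have "L \<in> candidates u" unfolding candidates_def using L near_refl[of E R u] by blast
  then show ?thesis using lam_fst[OF L] True by (metis less_Suc_eq_le)
next
  case False
  then have "Suc (\<tau> v) \<le> \<tau> u" using v(3) by simp
  then obtain L x where "L \<in> memory (\<tau> u) u" "fst L \<le> \<tau> v" "near E R u x" "lam (\<tau> u) x = Some L"
    using candidate_memory[OF u v(2) \<tau>_Some[OF v(1)]] by blast
  then show ?thesis using memory_Bag unfolding candidates_def by blast
qed

definition lab :: "'b \<Rightarrow> 'b label" where
  "lab u = (SOME L. L \<in> candidates u \<and> (\<forall>M\<in>candidates u. fst L \<le> fst M))"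

lemma lab:
  assumes "u \<in> V"
  shows "lab u \<in> candidates u" and "M \<in> candidates u \<Longrightarrow> fst (lab u) \<le> fst M"
proof -
  obtain L where "L \<in> candidates u" using candidate[OF assms assms] by auto
  then have "\<exists>L. L \<in> candidates u \<and> (\<forall>M\<in>candidates u. fst L \<le> fst M)"
    using ex_has_least_nat[of "\<lambda>L. L \<in> candidates u" L fst] by blast
  then have "lab u \<in> candidates u \<and> (\<forall>M\<in>candidates u. fst (lab u) \<le> fst M)"
    unfolding lab_def by (rule someI_ex)
  then show "lab u \<in> candidates u" "M \<in> candidates u \<Longrightarrow> fst (lab u) \<le> fst M" by blast+
qed

lemma lab_near_centre:
  assumes "u \<in> V" shows "near E (R * (k + 1)) (snd (lab u)) u"
proof -
  obtain x n where x: "near E R u x" "lam n x = Some (lab u)"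
    using lab(1)[OF assms] by (auto simp: candidates_def)
  then have "near E (R * k) (snd (lab u)) x" using radius_le[of n x "fst (lab u)" "snd (lab u)"] by simp
  then have "near E (R * k + R) (snd (lab u)) u" using near_sym[OF sym x(1)] by (rule near_trans)
  then show ?thesis by (simp add: add.commute)
qed

text \<open>Let \<open>f i\<close> be labelled first on a walk from \<open>u\<close> to
  \<open>v\<close>, in round \<open>t\<close>. At the start of that round the walk lies in one
  component. Both ends are within \<open>R\<close> of \<open>f i\<close>, so their oldest candidates
  are born by round \<open>t\<close>, and being remembered later they are in the bag of that
  round.\<close>

lemma lab_common_Bag:
  assumes u: "u \<in> V" and v: "v \<in> V" and uv: "near E R u v"
  shows "\<exists>t. lam t u = None \<and> lab u \<in> Bag t u \<and> lab v \<in> Bag t u"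
proof -
  obtain d where d: "d \<le> R" "(u, v) \<in> E ^^ d" using uv by (auto simp: near_def)
  then obtain f where f: "f 0 = u" "f d = v" "\<And>i. i < d \<Longrightarrow> (f i, f (Suc i)) \<in> E"
    unfolding relpow_fun_conv by blast
  have walk: "(f i, f (i + j)) \<in> E ^^ j" if "i + j \<le> d" for i j
    using that
  proof (induction j)
    case (Suc j)
    then have "(f i, f (i + j)) \<in> E ^^ j" "(f (i + j), f (Suc (i + j))) \<in> E" using f(3) by simp_all
    then show ?case by auto
  qed simp
  have fV: "f i \<in> V" if "i \<le> d" for i
    using that by (induction i) (use f u E_V in \<open>auto dest: Suc_le_lessD\<close>)
  obtain i where i: "i \<le> d" "\<And>j. j \<le> d \<Longrightarrow> \<tau> (f i) \<le> \<tau> (f j)"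
    using ex_has_least_nat[of "\<lambda>i. i \<le> d" 0 "\<lambda>i. \<tau> (f i)"] by auto
  define t where "t = \<tau> (f i)"
  have fN: "lam t (f j) = None" if "j \<le> d" for j
    using None_le_\<tau>[OF fV[OF that]] i(2)[OF that] by (simp add: t_def)
  have cm: "f j \<in> cm t u" if "j \<le> d" for j
    using that
  proof (induction j)
    case (Suc j)
    then show ?case using component_step[of "f j" E "lam t" u "f (Suc j)"] f(3) fN by simp
  qed (simp add: f)
  have main: "lab x \<in> Bag t u" if x: "x \<in> V" "near E R x (f i)" "x \<in> cm t u" "lam t x = None" for x
  proof -
    have le: "t \<le> \<tau> x" using le_\<tau> x by blast
    then obtain L where "L \<in> candidates x" "fst L \<le> t"
      using candidate[OF x(1) fV[OF i(1)] x(2)] t_def by blast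
    then have "fst (lab x) \<le> t" using lab(2)[OF x(1)] le_trans by blast
    moreover have "lab x \<in> Bag (\<tau> x) x" using lab(1)[OF x(1)] by (simp add: candidates_def)
    ultimately have "lab x \<in> Bag t x" using Bag_back[OF _ _ le \<tau>_None[OF x(1)]] by blast
    moreover have "lam t u = None" using fN[of 0] f(1) by simp
    ultimately show ?thesis using Bag_const[OF _ x(3)] by simp
  qed
  have "near E R u (f i)" using walk[of 0 i] i(1) d(1) f(1) unfolding near_def by (metis add_0 le_trans)
  moreover have "near E R (f i) v"
    using walk[of i "d - i"] i(1) d(1) f(2) unfolding near_def
    by (metis diff_le_self le_add_diff_inverse le_trans order_refl)
  then have "near E R v (f i)" by (rule near_sym[OF sym])
  ultimately have "lab u \<in> Bag t u" "lab v \<in> Bag t u"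
    using main[OF u] main[OF v] cm[of 0] cm[of d] fN[of 0] fN[of d] f by simp_all
  then show ?thesis using fN[of 0] f(1) by auto
qed

subsection \<open>The tree-decomposition of the quotient\<close>

text \<open>A node is a component together with its round, shifted by one to make room for the extra
  root \<open>(0, {})\<close>, which joins the components of the initial round into one
  tree.\<close>

definition nodes :: "(nat \<times> 'b set) set" where
  "nodes = insert (0, {}) {(Suc t, cm t u) | t u. u \<in> V \<and> lam t u = None}"

text \<open>The component one round earlier. Only the set is stored, so \<open>pick\<close> supplies
  a vertex of it; the offset 2 is the shift of rounds plus one step back.\<close>

definition parent :: "nat \<times> 'b set \<Rightarrow> nat \<times> 'b set" where
  "parent x = (if fst x \<le> 1 then (0, {}) else (fst x - 1, cm (fst x - 2) (pick (snd x))))"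

definition node_bag :: "nat \<times> 'b set \<Rightarrow> 'b label set" where
  "node_bag x = (if fst x = 0 then {} else Bag (fst x - 1) (pick (snd x)))"

lemma pick_cm: "pick (cm t u) \<in> cm t u"
  using pick[of u "cm t u"] by simp

lemma node_bag_Suc:
  assumes "lam t u = None" shows "node_bag (Suc t, cm t u) = Bag t u"
  using Bag_const[OF assms pick_cm] by (simp add: node_bag_def)

lemma parent_0: "parent (Suc 0, S) = (0, {})"
  by (simp add: parent_def)

lemma parent_Suc: "parent (Suc (Suc t), cm (Suc t) u) = (Suc t, cm t u)"
proof -
  have "pick (cm (Suc t) u) \<in> cm t u" using pick_cm cm_mono[of t "Suc t" u] by auto
  then have "cm t (pick (cm (Suc t) u)) = cm t u" by (rule component_eq[OF sym])
  then show ?thesis by (simp add: parent_def)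
qed

lemma node_in: "u \<in> V \<Longrightarrow> lam t u = None \<Longrightarrow> (Suc t, cm t u) \<in> nodes"
  unfolding nodes_def by blast

sublocale tree: parent_tree nodes "(0, {})" parent fst
proof
  show "(0, {}) \<in> nodes" by (simp add: nodes_def)
  show "parent x \<in> nodes" if xn: "x \<in> nodes" "x \<noteq> (0, {})" for x
  proof -
    obtain t u where x: "x = (Suc t, cm t u)" "u \<in> V" "lam t u = None"
      using xn by (auto simp: nodes_def)
    show ?thesis
    proof (cases t)
      case 0
      then show ?thesis using x by (simp add: parent_0 nodes_def)
    next
      case (Suc t')
      then have "lam t' u = None" using lam_None_mono[OF x(3), of t'] by simp
      then show ?thesis using x Suc parent_Suc node_in by simp
    qed
  qed
  show "fst (parent x) < fst x" if "x \<in> nodes" "x \<noteq> (0, {})" for x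
    using that by (auto simp: nodes_def parent_def)
qed

lemma node_bag_card:
  assumes "x \<in> nodes" shows "finite (node_bag x) \<and> card (node_bag x) \<le> k + 1"
  using assms Bag_card node_bag_Suc by (auto simp: nodes_def node_bag_def[of "(0, {})"])

text \<open>The top node is the component at the birth of the class. In every other node whose bag
  has the label, it is remembered rather than newborn, so it is also in the bag of the
  parent.\<close>

lemma label_connected:
  assumes "lam n x = Some (m, z)"
  shows "connected_graph (induced_subgraph tree.T {x \<in> nodes. (m, z) \<in> node_bag x})"
proof (rule tree.connected_subtree[where s = "(Suc m, cm m z)"])
  note c = centre[OF assms]
  have "(m, z) \<in> Bag m z" using c by (simp add: Bag_def)
  then show "(Suc m, cm m z) \<in> {x \<in> nodes. (m, z) \<in> node_bag x}"
    using c node_in node_bag_Suc by simp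
  show "x \<noteq> (0, {}) \<and> parent x \<in> {x \<in> nodes. (m, z) \<in> node_bag x}"
    if x: "x \<in> {x \<in> nodes. (m, z) \<in> node_bag x}" "x \<noteq> (Suc m, cm m z)" for x
  proof -
    have "x \<noteq> (0, {})" using x by (auto simp: node_bag_def)
    then obtain t u where t: "x = (Suc t, cm t u)" "u \<in> V" "lam t u = None"
      using x by (auto simp: nodes_def)
    then have mz: "(m, z) \<in> Bag t u" using x node_bag_Suc by simp
    have "(m, z) \<in> memory t u"
    proof (rule ccontr)
      assume "(m, z) \<notin> memory t u"
      then have "m = t" "z = pick (cm t u)" using mz by (auto simp: Bag_def split: if_splits)
      then have "z \<in> cm t u" using pick_cm by simp
      then have "cm t z = cm t u" by (rule component_eq[OF sym])
      then show False using x(2) t(1) \<open>m = t\<close> by simp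
    qed
    moreover from this obtain t' where t': "t = Suc t'" using memory_fst by (cases t) fastforce+
    moreover have N: "lam t' u = None" using lam_None_mono[OF t(3), of t'] t' by simp
    ultimately have "(m, z) \<in> Bag t' u" using memory_Suc_sub by blast
    then show ?thesis using \<open>x \<noteq> (0, {})\<close> t(1) t' parent_Suc node_in[OF t(2) N] node_bag_Suc[OF N]
      by simp
  qed
qed auto

section \<open>The parts and the treewidth of the quotient\<close>

definition part :: "'a graph \<Rightarrow> ('a \<Rightarrow> 'b) \<Rightarrow> 'b label \<Rightarrow> 'a set" where
  "part G \<phi> L = {a \<in> verts G. lab (\<phi> a) = L}"

definition parts :: "'a graph \<Rightarrow> ('a \<Rightarrow> 'b) \<Rightarrow> 'a set set" where
  "parts G \<phi> = (\<lambda>a. part G \<phi> (lab (\<phi> a))) ` verts G"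

lemma partition_parts: "partition_on (verts G) (parts G \<phi>)"
  by (auto simp: partition_on_def parts_def part_def disjoint_def)

text \<open>Labels in the node bags are replaced by their parts, and labels not in use are dropped.
  Edges are covered by \<open>lab_common_Bag\<close>, and the nodes of a part are those of its
  label.\<close>

lemma treewidth_quotient:
  fixes G :: "'a graph"
  assumes G: "simple_graph G" and \<phi>: "\<phi> \<in> verts G \<rightarrow> V"
    and near: "\<And>a b. {a, b} \<in> edges G \<Longrightarrow> near E R (\<phi> a) (\<phi> b)"
  shows "treewidth (quotient_graph G (parts G \<phi>)) \<le> enat k"
proof (rule treewidth_leI)
  define B where "B x = part G \<phi> ` (node_bag x \<inter> (\<lambda>a. lab (\<phi> a)) ` verts G)" for x
  have part_B: "part G \<phi> (lab (\<phi> a)) \<in> B x \<longleftrightarrow> lab (\<phi> a) \<in> node_bag x" if a: "a \<in> verts G" for a x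
  proof
    assume "part G \<phi> (lab (\<phi> a)) \<in> B x"
    then obtain L where "L \<in> node_bag x" "part G \<phi> (lab (\<phi> a)) = part G \<phi> L" by (auto simp: B_def)
    moreover have "a \<in> part G \<phi> (lab (\<phi> a))" using a by (simp add: part_def)
    ultimately show "lab (\<phi> a) \<in> node_bag x" by (simp add: part_def)
  qed (use a in \<open>auto simp: B_def\<close>)
  show "simple_graph (quotient_graph G (parts G \<phi>))"
    unfolding simple_graph_def quotient_graph_def by auto
  show "width_at_most tree.T B k"
    unfolding width_at_most_def
  proof
    fix x assume "x \<in> verts tree.T"
    then have f: "finite (node_bag x)" "card (node_bag x) \<le> k + 1"
      using node_bag_card tree.verts_T by auto
    have "card (B x) \<le> card (node_bag x)"
      by (rule surj_card_le[OF f(1), of _ "part G \<phi>"]) (auto simp: B_def)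
    then show "finite (B x) \<and> card (B x) \<le> k + 1" using f by (simp add: B_def)
  qed
  show "tree_decomposition (quotient_graph G (parts G \<phi>)) tree.T B"
    unfolding tree_decomposition_def
  proof (intro conjI ballI)
    show "tree tree.T" by (rule tree.tree_T)
    show "B x \<subseteq> verts (quotient_graph G (parts G \<phi>))" for x
      by (auto simp: B_def quotient_graph_def parts_def)
  next
    fix e assume "e \<in> edges (quotient_graph G (parts G \<phi>))"
    then obtain X Y u v where e: "e = {X, Y}" "X \<in> parts G \<phi>" "Y \<in> parts G \<phi>" "u \<in> X" "v \<in> Y"
      "{u, v} \<in> edges G"
      by (auto simp: quotient_graph_def)
    then have uv: "u \<in> verts G" "v \<in> verts G" "X = part G \<phi> (lab (\<phi> u))" "Y = part G \<phi> (lab (\<phi> v))"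
      by (auto simp: parts_def part_def)
    have V: "\<phi> u \<in> V" "\<phi> v \<in> V" using \<phi> uv by auto
    obtain t where t: "lam t (\<phi> u) = None" "lab (\<phi> u) \<in> Bag t (\<phi> u)" "lab (\<phi> v) \<in> Bag t (\<phi> u)"
      using lab_common_Bag[OF V near[OF e(6)]] by blast
    then have "e \<subseteq> B (Suc t, cm t (\<phi> u))"
      using e(1) uv part_B node_bag_Suc[OF t(1)] by simp
    then show "\<exists>x\<in>verts tree.T. e \<subseteq> B x" using node_in[OF V(1) t(1)] tree.verts_T by blast
  next
    fix X assume "X \<in> verts (quotient_graph G (parts G \<phi>))"
    then obtain a where a: "a \<in> verts G" "X = part G \<phi> (lab (\<phi> a))"
      by (auto simp: quotient_graph_def parts_def)
    define S where "S = {x \<in> nodes. lab (\<phi> a) \<in> node_bag x}"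
    have "\<phi> a \<in> V" using a \<phi> by auto
    then obtain n x where "lam n x = Some (lab (\<phi> a))"
      using lab(1)[OF \<open>\<phi> a \<in> V\<close>] unfolding candidates_def by blast
    then have "connected_graph (induced_subgraph tree.T S)"
      unfolding S_def by (cases "lab (\<phi> a)") (auto dest: label_connected)
    moreover have "induced_subgraph tree.T S = induced_subgraph tree.T {x. X \<in> B x}"
    proof -
      have "e \<subseteq> nodes" if "e \<in> edges tree.T" for e
        using that tree.par unfolding tree.edges_T by blast
      moreover have "S = nodes \<inter> {x. X \<in> B x}" using part_B[OF a(1)] a(2) by (auto simp: S_def)
      ultimately show ?thesis by (auto simp: induced_subgraph_def tree.verts_T)
    qed
    ultimately show "connected_graph (induced_subgraph tree.T {x. X \<in> B x})" by simp
  qed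
qed

lemma near_in_part:
  assumes "\<phi> \<in> verts G \<rightarrow> V" "X \<in> parts G \<phi>" "a \<in> X" "b \<in> X"
  shows "near E (2 * (R * (k + 1))) (\<phi> a) (\<phi> b)"
proof -
  have "lab (\<phi> a) = lab (\<phi> b)" "\<phi> a \<in> V" "\<phi> b \<in> V" using assms by (auto simp: parts_def part_def)
  then have "near E (R * (k + 1)) (snd (lab (\<phi> a))) (\<phi> a)" "near E (R * (k + 1)) (snd (lab (\<phi> a))) (\<phi> b)"
    using lab_near_centre[of "\<phi> a"] lab_near_centre[of "\<phi> b"] by simp_all
  then have "near E (R * (k + 1) + R * (k + 1)) (\<phi> a) (\<phi> b)"
    using near_trans[OF near_sym[OF sym]] by blast
  then show ?thesis by (simp only: mult_2)
qed

end

section \<open>Levels and bags from a tree-decomposition of \<open>H\<close>\<close>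

text \<open>The level of a vertex is the depth of the topmost node whose bag contains it; this bag is
  attached to the vertex.\<close>

lemma tree_decomposition_layered:
  fixes H :: "'b graph" and T :: "'t graph"
  assumes td: "tree_decomposition H T B" and w: "width_at_most T B k"
    and H: "simple_graph H"
  shows "\<exists>lv bag. layered (verts H) (adjacency H) lv bag k"
proof -
  have T: "tree T" using td by (simp add: tree_decomposition_def)
  then obtain r where r: "r \<in> verts T" by (auto simp: tree_def connected_graph_def)
  let ?dep = "depth T r" and ?D = "below T r"
  have con: "connected_graph (induced_subgraph T {x. v \<in> B x})" if "v \<in> verts H" for v
    using td that by (simp add: tree_decomposition_def)
  have "\<exists>x. x \<in> verts T \<and> v \<in> B x \<and> (\<forall>x'\<in>verts T. v \<in> B x' \<longrightarrow> ?dep x \<le> ?dep x')"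
    if "v \<in> verts H" for v
  proof -
    have "\<exists>x. x \<in> verts T \<and> v \<in> B x"
      using con[OF that] by (auto simp: connected_graph_def induced_subgraph_def)
    then show ?thesis
      using ex_has_least_nat[of "\<lambda>x. x \<in> verts T \<and> v \<in> B x" _ ?dep] by blast
  qed
  then obtain t where t: "\<And>v. v \<in> verts H \<Longrightarrow> t v \<in> verts T \<and> v \<in> B (t v)"
    and t_min: "\<And>v x'. v \<in> verts H \<Longrightarrow> x' \<in> verts T \<Longrightarrow> v \<in> B x' \<Longrightarrow> ?dep (t v) \<le> ?dep x'"
    by metis
  define lv where "lv v = ?dep (t v)" for v
  \<comment> \<open>The nodes whose bags contain \<open>v\<close> are connected. If some lie below
    \<open>y\<close> and some do not, they include \<open>y\<close> and a neighbour of
    \<open>y\<close> of smaller depth.\<close>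
  have cross: "v \<in> B y \<and> (\<exists>x''\<in>verts T. v \<in> B x'' \<and> ?dep x'' < ?dep y)"
    if v: "v \<in> verts H" "x \<in> ?D y" "v \<in> B x" "x' \<in> verts T" "x' \<notin> ?D y" "v \<in> B x'"
    for v x x' y
  proof -
    have "x \<in> verts T" using v by (auto simp: below_def[OF T r])
    then obtain p where p: "walk (induced_subgraph T {x. v \<in> B x}) p" "hd p = x" "last p = x'"
      using con[OF v(1)] v by (auto simp: connected_graph_def induced_subgraph_def)
    then have "walk T p" "set p \<subseteq> {x. v \<in> B x}" by (simp_all add: walk_induced_subgraph)
    then obtain a b where ab: "v \<in> B a" "v \<in> B b" "a \<in> ?D y" "b \<notin> ?D y" "{a, b} \<in> edges T"
      "b \<in> verts T" "a \<in> verts T"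
      using walk_leaves[of T p "?D y"] p v unfolding walk_def by blast
    then have "a = y" using below_leave[OF T r] by blast
    then show ?thesis using ab depth_parent[OF T r] by blast
  qed
  have adjD: "a \<in> verts H \<and> b \<in> verts H \<and> (\<exists>n\<in>verts T. a \<in> B n \<and> b \<in> B n)"
    if "(a, b) \<in> adjacency H" for a b
  proof -
    have e: "{a, b} \<in> edges H" using that by (simp add: adjacency_def)
    then obtain u v where uv: "u \<in> verts H" "v \<in> verts H" "{a, b} = {u, v}"
      using H unfolding simple_graph_def by blast
    obtain n where "n \<in> verts T" "{a, b} \<subseteq> B n"
      using td e unfolding tree_decomposition_def by blast
    moreover have "a \<in> {u, v}" "b \<in> {u, v}" using uv(3) by blast+
    ultimately show ?thesis using uv(1,2) by auto
  qed
  \<comment> \<open>A vertex reached from \<open>x\<close> that also had a node outside would, by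
    \<open>cross\<close>, have a node of depth smaller than that of \<open>t x\<close>, contrary to
    its level.\<close>
  have inside: "w \<in> verts H \<and> (\<forall>n\<in>verts T. w \<in> B n \<longrightarrow> n \<in> ?D (t x))"
    if x: "x \<in> verts H"
      and "(x, w) \<in> {(a, b) \<in> adjacency H. lv x \<le> lv a \<and> lv x \<le> lv b}\<^sup>*" for x w
    using that(2)
  proof (induction rule: rtrancl_induct)
    case base
    have "t x \<in> ?D (t x)"
      using t[OF x] last_in_set by (force simp: below_def[OF T r] rooted_walk_def[OF T r] walk_def)
    show ?case
    proof (intro conjI x ballI impI)
      fix n assume n: "n \<in> verts T" "x \<in> B n"
      show "n \<in> ?D (t x)"
      proof (rule ccontr)
        assume "n \<notin> ?D (t x)"
        then obtain m where "m \<in> verts T" "x \<in> B m" "?dep m < ?dep (t x)"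
          using cross[OF x \<open>t x \<in> ?D (t x)\<close> _ n(1) _ n(2)] t[OF x] by blast
        then show False using t_min[OF x] not_le by blast
      qed
    qed
  next
    case (step a b)
    then have b: "b \<in> verts H" "lv x \<le> lv b" using adjD by auto
    obtain n where "n \<in> verts T" "a \<in> B n" "b \<in> B n" using adjD step by blast
    then have n: "n \<in> ?D (t x)" "b \<in> B n" using step by blast+
    show ?case
    proof (intro conjI b(1) ballI impI)
      fix n' assume n': "n' \<in> verts T" "b \<in> B n'"
      show "n' \<in> ?D (t x)"
      proof (rule ccontr)
        assume "n' \<notin> ?D (t x)"
        then obtain m where "m \<in> verts T" "b \<in> B m" "?dep m < ?dep (t x)"
          using cross[OF b(1) n n'(1) _ n'(2)] by blast
        then show False using t_min[OF b(1)] b(2) unfolding lv_def by (meson leD order_trans)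
      qed
    qed
  qed
  have "layered (verts H) (adjacency H) lv (\<lambda>x. B (t x)) k"
  proof
    show "sym (adjacency H)" by (auto simp: sym_def adjacency_def insert_commute)
    show "adjacency H \<subseteq> verts H \<times> verts H" using adjD by auto
  next
    show "x \<in> B (t x) \<and> finite (B (t x)) \<and> card (B (t x)) \<le> k + 1" if "x \<in> verts H" for x
      using t[OF that] w by (auto simp: width_at_most_def)
  next
    fix x y z
    assume x: "x \<in> verts H"
      and y: "(x, y) \<in> {(a, b) \<in> adjacency H. lv x \<le> lv a \<and> lv x \<le> lv b}\<^sup>*"
      and z: "(y, z) \<in> adjacency H" "lv z \<le> lv x"
    obtain n where n: "n \<in> verts T" "y \<in> B n" "z \<in> B n" "z \<in> verts H" using adjD z by blast
    then have "n \<in> ?D (t x)" using inside[OF x y] by blast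
    \<comment> \<open>If \<open>t z\<close> is below \<open>t x\<close>, the levels force equality;
      if not, the nodes of \<open>z\<close> leave the subtree through \<open>t x\<close>.\<close>
    show "z \<in> B (t x)"
    proof (cases "t z \<in> ?D (t x)")
      case True
      then have "t z = t x" using depth_below[OF T r] z(2) unfolding lv_def by (meson not_le)
      then show ?thesis using t n by metis
    next
      case False
      then show ?thesis using cross[OF n(4) \<open>n \<in> ?D (t x)\<close> n(3)] t[OF n(4)] by blast
    qed
  qed
  then show ?thesis by blast
qed

section \<open>Graph distance and powers of the adjacency relation\<close>

lemma adjacency_verts:
  assumes "simple_graph H" "(x, y) \<in> adjacency H" shows "x \<in> verts H \<and> y \<in> verts H"
proof -
  have "{x, y} \<in> edges H" using assms(2) by (simp add: adjacency_def)
  then obtain u v where "u \<in> verts H" "v \<in> verts H" "{x, y} = {u, v}"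
    using assms(1) unfolding simple_graph_def by blast
  then show ?thesis by (auto simp: doubleton_eq_iff)
qed

lemma gdist_relpow:
  assumes "simple_graph H" "x \<in> verts H" "(x, y) \<in> adjacency H ^^ i"
  shows "gdist H x y \<le> enat i"
proof -
  have "\<exists>p. walk H p \<and> hd p = x \<and> last p = y \<and> length p = Suc i"
    using assms(3)
  proof (induction i arbitrary: y)
    case 0
    then show ?case using assms(2) by (intro exI[of _ "[x]"]) auto
  next
    case (Suc i)
    then obtain z where z: "(x, z) \<in> adjacency H ^^ i" "(z, y) \<in> adjacency H" by auto
    then obtain p where p: "walk H p" "hd p = x" "last p = z" "length p = Suc i"
      using Suc.IH by blast
    then have "p \<noteq> []" by auto
    have "walk H (p @ [y])"
      using p z(2) \<open>p \<noteq> []\<close> adjacency_verts[OF assms(1) z(2)]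
      by (subst walk_append_iff) (auto simp: adjacency_def)
    then show ?case using p \<open>p \<noteq> []\<close> by (intro exI[of _ "p @ [y]"]) auto
  qed
  then obtain p where "walk H p" "hd p = x" "last p = y" "length p - 1 = i" by auto
  then show ?thesis unfolding gdist_def by (intro INF_lower2[of p]) auto
qed

lemma walk_relpow: "walk H p \<Longrightarrow> (hd p, last p) \<in> adjacency H ^^ (length p - 1)"
proof (induction p rule: induct_list012)
  case (3 x y zs)
  then have "(x, y) \<in> adjacency H" "(y, last (y # zs)) \<in> adjacency H ^^ (length (y # zs) - 1)"
    by (auto simp: walk_def adjacency_def)
  then have "(x, last (y # zs)) \<in> adjacency H ^^ Suc (length (y # zs) - 1)" by (rule relpow_Suc_I2)
  then show ?case by simp
qed (auto simp: walk_def)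

lemma near_gdist:
  assumes "gdist H x y \<le> enat r" shows "near (adjacency H) r x y"
proof -
  let ?W = "{p. walk H p \<and> hd p = x \<and> last p = y}"
  have "?W \<noteq> {}"
  proof
    assume "?W = {}"
    then have "gdist H x y = \<infinity>"
      unfolding gdist_def by (simp only: image_empty Inf_empty top_enat_def)
    then show False using assms by simp
  qed
  then have "gdist H x y \<in> (\<lambda>p. enat (length p - 1)) ` ?W"
    unfolding gdist_def by (metis (lifting) empty_is_image equals0I wellorder_InfI)
  then obtain p where "walk H p" "hd p = x" "last p = y" "gdist H x y = enat (length p - 1)" by auto
  then show ?thesis using walk_relpow[of H p] assms unfolding near_def by auto
qed

theorem theorem2:
  fixes c :: real and k :: nat and G :: "'a graph" and H :: "'b graph"
  assumes "1 \<le> c"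
    and "simple_graph G" and "simple_graph H"
    and "treewidth H \<le> enat k"
    and "quasi_isometric c G H"
  shows "\<exists>P. partition_on (verts G) P \<and>
             treewidth (quotient_graph G P) \<le> enat k \<and>
             (\<forall>S\<in>P. ereal_of_enat (weak_diameter G S) \<le> ereal (4 * (real k + 1) * c\<^sup>2 + c))"
proof -
  obtain \<phi> where q: "quasi_isometry c G H \<phi>" using assms(5) by (auto simp: quasi_isometric_def)
  then have \<phi>: "\<phi> \<in> verts G \<rightarrow> verts H" by (simp add: quasi_isometry_def)
  obtain T :: "('b + nat) graph" and B where td: "tree_decomposition H T B" "width_at_most T B k"
    using treewidth_leD[OF assms(4)] by blast
  obtain lv bag where lay: "layered (verts H) (adjacency H) lv bag k"
    using tree_decomposition_layered[OF td assms(3)] by blast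
  \<comment> \<open>The ends of an edge of \<open>G\<close> have distance at most 1, so their images
    have distance at most \<open>c * 1 + c\<close>.\<close>
  define R where "R = nat \<lfloor>2 * c\<rfloor>"
  have R: "real R \<le> 2 * c" using assms(1) by (simp add: R_def)
  interpret layered "verts H" "adjacency H" lv bag k R by (rule lay)
  have edge: "near (adjacency H) R (\<phi> a) (\<phi> b)" if e: "{a, b} \<in> edges G" for a b
  proof -
    obtain u v where uv: "u \<in> verts G" "v \<in> verts G" "u \<noteq> v" "{a, b} = {u, v}"
      using assms(2) e unfolding simple_graph_def by blast
    then have ab: "a \<in> verts G" "b \<in> verts G" "a \<noteq> b" by (auto simp: doubleton_eq_iff)
    have "gdist G a b \<le> enat 1"
      using e ab gdist_relpow[OF assms(2), of a b 1] by (simp add: adjacency_def)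
    then obtain g where g: "gdist G a b = enat g" "g \<le> 1" by (cases "gdist G a b") auto
    have "ereal_of_enat (gdist H (\<phi> a) (\<phi> b)) \<le> ereal c * ereal_of_enat (gdist G a b) + ereal c"
      using q ab by (simp add: quasi_isometry_def)
    then have le: "ereal_of_enat (gdist H (\<phi> a) (\<phi> b)) \<le> ereal (c * real g + c)" using g by simp
    then obtain d where d: "gdist H (\<phi> a) (\<phi> b) = enat d" by (cases "gdist H (\<phi> a) (\<phi> b)") auto
    have "c * real g \<le> c" using g(2) assms(1) by (cases g) auto
    then have "real d \<le> 2 * c" using le d by simp
    then have "d \<le> R" by (simp add: R_def le_nat_floor)
    then show ?thesis using near_gdist[of H "\<phi> a" "\<phi> b" R] d by simp
  qed
  let ?P = "parts G \<phi>" and ?b = "4 * (real k + 1) * c\<^sup>2 + c"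
  have "ereal_of_enat (weak_diameter G S) \<le> ereal ?b" if S: "S \<in> ?P" for S
  proof -
    define M where "M = nat \<lfloor>?b\<rfloor>"
    have b0: "0 \<le> ?b" using assms(1) by simp
    have "gdist G a b \<le> enat M" if ab: "a \<in> S" "b \<in> S" for a b
    proof (cases "a = b")
      case True
      \<comment> \<open>The inequalities of a quasi-isometry are given for distinct vertices
        only.\<close>
      have "a \<in> verts G" using S ab by (auto simp: parts_def part_def)
      then have "gdist G a b \<le> enat 0" using gdist_relpow[OF assms(2), of a b 0] True by simp
      then show ?thesis by (metis enat_ord_simps(1) order_trans zero_le)
    next
      case False
      have abV: "a \<in> verts G" "b \<in> verts G" using S ab by (auto simp: parts_def part_def)
      let ?D = "2 * (R * (k + 1))"
      obtain i where i: "i \<le> ?D" "(\<phi> a, \<phi> b) \<in> adjacency H ^^ i"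
        using near_in_part[OF \<phi> S ab] by (auto simp: near_def)
      then have "gdist H (\<phi> a) (\<phi> b) \<le> enat i"
        using gdist_relpow[OF assms(3)] \<phi> abV by auto
      then obtain d where d: "gdist H (\<phi> a) (\<phi> b) = enat d" "d \<le> ?D"
        using i(1) by (cases "gdist H (\<phi> a) (\<phi> b)") auto
      have "ereal_of_enat (gdist G a b) \<le> ereal c * ereal_of_enat (gdist H (\<phi> a) (\<phi> b)) + ereal c"
        using q abV False by (simp add: quasi_isometry_def)
      then have le: "ereal_of_enat (gdist G a b) \<le> ereal (c * real d + c)" using d by simp
      then obtain g where g: "gdist G a b = enat g" by (cases "gdist G a b") auto
      \<comment> \<open>With \<open>R\<close> at most \<open>2 * c\<close>, the diameter in
        \<open>H\<close> is at most \<open>4 * c * (k + 1)\<close>; passing back to \<open>G\<close>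
        multiplies it by \<open>c\<close> and adds \<open>c\<close>.\<close>
      have "real d \<le> real ?D" using d(2) by (simp only: of_nat_le_iff)
      also have "\<dots> = 2 * (real R * (real k + 1))" by (simp add: algebra_simps)
      also have "\<dots> \<le> 2 * ((2 * c) * (real k + 1))"
        using R by (intro mult_left_mono mult_right_mono) auto
      finally have "c * real d \<le> c * (2 * ((2 * c) * (real k + 1)))"
        using assms(1) by (intro mult_left_mono) auto
      then have "real g \<le> ?b" using le g by (simp add: power2_eq_square algebra_simps)
      then show ?thesis using g by (simp add: M_def le_nat_floor)
    qed
    then have "weak_diameter G S \<le> enat M" unfolding weak_diameter_def by (intro SUP_least) blast
    then obtain g where g: "weak_diameter G S = enat g" "g \<le> M" by (cases "weak_diameter G S") auto
    have "real g \<le> real M" using g(2) by simp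
    also have "real M \<le> ?b" using b0 unfolding M_def by (rule of_nat_floor)
    finally show ?thesis using g by simp
  qed
  moreover have "treewidth (quotient_graph G ?P) \<le> enat k"
    using assms(2) \<phi> edge by (rule treewidth_quotient)
  ultimately show ?thesis using partition_parts by blast
qed

end
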